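(* Let $d\ge 1$ and $k\ge 1$ be fixed integers. For each $n$, let $\mathcal X_n$ be a set of $n$ points sampled independently and uniformly from the unit cube $[-\tfrac12,\tfrac12]^d$, let $\check C(\mathcal X_n)$ be the (complete) Čech filtration on $\mathcal X_n$ with its simplices ordered $\rho$-lexicographically, let $D$ be its $k$-dimensional boundary matrix and let $D'$ be the reduced matrix obtained from $D$ by matrix reduction. Then, as $n\to\infty$, $$\mathbb E[\# D']=\mathcal O\big(n^{2}(\log n)^{2k}+n^{k+1}\big),$$ and the expected cost of the matrix reduction satisfies $$\mathbb E[\mathrm{cost}(D)]=\mathcal O\big(n^{k+4}(\log n)^{2k}+n^{2k+3}\big).$$
   Context: **Matrix reduction.** Matrices have entries in $\mathbb Z_2$. For a non-zero column $M_i$, its pivot $low(M_i)$ is the index of the lowest row (i.e. the largest row index) with a non-zero entry. $\#M_i$ is the number of non-zero entries of column $M_i$, and $\#M=\sum_i\#M_i$. Matrix reduction of $M=(M_1,\dots,M_c)$ is the following algorithm: for $i=1,\dots,c$ in order, set $M'_i:=M_i$; while $M'_i\ne 0$ and there is $j<i$ with $low(M'_j)=low(M'_i)$, replace $M'_i$ by $M'_i+M'_j$. The output $M'=(M'_1,\dots,M'_c)$ is the reduced matrix and $\#M'$ is called the fill-in. The cost of one addition $M'_i\leftarrow M'_i+M'_j$ is $\#M'_j$, and $\mathrm{cost}(M)$ is the sum of the costs of all column additions performed. **Boundary matrix.** For a finite simplicial complex with a total order on the simplices of each dimension, the $k$-dimensional boundary matrix has rows indexed by the $k$-simplices and columns indexed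 by the $(k+1)$-simplices, in the given orders, and entry $1$ if the $k$-simplex is a facet of the $(k+1)$-simplex, $0$ otherwise. **Čech filtration.** For a finite point set $\mathcal P_n\subset\mathbb R^d$, the Čech complex at scale $\alpha$, $\check C(\mathcal P_n,\alpha)$, has vertex set $\mathcal P_n$ and contains all simplices $\sigma$ with $\bigcap_{p\in\sigma}B_\alpha(p)\ne\emptyset$, where $B_\alpha(p)$ is the closed ball of radius $\alpha$ around $p$. The entrance time $\rho_\sigma$ of a simplex $\sigma$ is the smallest $\alpha$ with $\sigma\in\check C(\mathcal P_n,\alpha)$ (equivalently, the radius of the smallest enclosing ball of $\sigma$). The Čech filtration runs over all scales from $0$ until the full simplex on $n$ vertices is reached, so all $\binom n{k+1}$ $k$-simplices and all $\binom n{k+2}$ $(k+1)$-simplices occur. **$\rho$-lexicographic order.** Simplices are ordered first by entrance time, then by dimension, then lexicographically with respect to the total order on the vertices given by their indices. Asymptotic constants may depend on $k$ and $d$ only. *)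

theory Defs
  imports
    "HOL-Probability.Probability"
    "HOL-Library.Landau_Symbols"
    "HOL-Library.While_Combinator"
    "HOL-Library.Z2"
    "Jordan_Normal_Form.Matrix"
begin

section \<open>Matrix reduction over the field with two elements\<close>

text \<open>The type \<^typ>\<open>bit\<close> is the field with two elements. Rows and columns are indexed from 0.\<close>

text \<open>The pivot; meaningful only for non-zero vectors.\<close>
definition low :: "bit vec \<Rightarrow> nat" where
  "low v = Max {r. r < dim_vec v \<and> vec_index v r \<noteq> 0}"

definition nnz_vec :: "bit vec \<Rightarrow> nat" where
  "nnz_vec v = card {r. r < dim_vec v \<and> vec_index v r \<noteq> 0}"

definition nnz_mat :: "bit mat \<Rightarrow> nat" where
  "nnz_mat M = (\<Sum>i<dim_col M. nnz_vec (col M i))"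

text \<open>\<open>R\<close> is the list of the already reduced columns, i.e. of the columns with smaller index. Those
  of its members that are non-zero have pairwise distinct pivots, so at most one column qualifies
  in \<open>find_reducer\<close> (\<open>matrix_reduction_distinct_pivots\<close> below).\<close>
definition find_reducer :: "bit vec list \<Rightarrow> bit vec \<Rightarrow> bit vec option" where
  "find_reducer R v =
     (if v = 0\<^sub>v (dim_vec v) then None
      else find (\<lambda>w. w \<noteq> 0\<^sub>v (dim_vec w) \<and> low w = low v) R)"

text \<open>The second component of the state accumulates the cost of the column additions.\<close>
definition reduce_column :: "bit vec list \<Rightarrow> bit vec \<times> nat \<Rightarrow> bit vec \<times> nat" where
  "reduce_column R =
     while (\<lambda>(v, c). find_reducer R v \<noteq> None)
           (\<lambda>(v, c). let w = the (find_reducer R v) in (v + w, c + nnz_vec w))"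

definition matrix_reduction :: "bit mat \<Rightarrow> bit vec list \<times> nat" where
  "matrix_reduction M =
     foldl (\<lambda>(R, c) v. let (v', c') = reduce_column R (v, c) in (R @ [v'], c')) ([], 0) (cols M)"

definition reduced_matrix :: "bit mat \<Rightarrow> bit mat" where
  "reduced_matrix M = mat_of_cols (dim_row M) (fst (matrix_reduction M))"

definition reduction_cost :: "bit mat \<Rightarrow> nat" where
  "reduction_cost M = snd (matrix_reduction M)"

subsection \<open>The loop terminates and pivots become distinct\<close>

lemma low_props:
  assumes "v \<noteq> 0\<^sub>v (dim_vec v)"
  shows "low v < dim_vec v" "vec_index v (low v) \<noteq> 0"
    and "\<And>r. r < dim_vec v \<Longrightarrow> vec_index v r \<noteq> 0 \<Longrightarrow> r \<le> low v"
proof -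
  let ?S = "{r. r < dim_vec v \<and> vec_index v r \<noteq> 0}"
  have "?S \<noteq> {}"
  proof
    assume "?S = {}"
    then have "v = 0\<^sub>v (dim_vec v)" by (intro eq_vecI) auto
    with assms show False by simp
  qed
  then have "Max ?S \<in> ?S" by (intro Max_in) auto
  then show "low v < dim_vec v" "vec_index v (low v) \<noteq> 0" by (auto simp: low_def)
  show "r \<le> low v" if "r < dim_vec v" "vec_index v r \<noteq> 0" for r
    unfolding low_def using that by (intro Max_ge) auto
qed

lemma low_add_less:
  assumes "v \<noteq> 0\<^sub>v (dim_vec v)" "w \<noteq> 0\<^sub>v (dim_vec w)" "dim_vec v = dim_vec w" "low w = low v"
    and nz: "v + w \<noteq> 0\<^sub>v (dim_vec (v + w))"
  shows "low (v + w) < low v"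
proof -
  let ?r = "low (v + w)"
  have r: "?r < dim_vec w" "vec_index v ?r + vec_index w ?r \<noteq> 0"
    using low_props[OF nz] by auto
  then have "vec_index v ?r \<noteq> 0 \<or> vec_index w ?r \<noteq> 0" by auto
  then have "?r \<le> low v" using low_props(3)[OF assms(1)] low_props(3)[OF assms(2)] r assms by auto
  moreover have "?r \<noteq> low v"
    using r low_props(2)[OF assms(1)] low_props(2)[OF assms(2)] assms(4) by auto
  ultimately show ?thesis by simp
qed

lemma find_reducerD:
  assumes "find_reducer R v = Some w"
  shows "w \<in> set R" "v \<noteq> 0\<^sub>v (dim_vec v)" "w \<noteq> 0\<^sub>v (dim_vec w)" "low w = low v"
  using assms unfolding find_reducer_def
  by (auto split: if_splits simp: find_Some_iff)

lemma find_reducer_None_iff: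
  "find_reducer R v = None \<longleftrightarrow>
     v = 0\<^sub>v (dim_vec v) \<or> (\<forall>w\<in>set R. w = 0\<^sub>v (dim_vec w) \<or> low w \<noteq> low v)"
  unfolding find_reducer_def by (auto simp: find_None_iff)

lemma reduce_column_unfold:
  "reduce_column R (v, c) =
     (case find_reducer R v of None \<Rightarrow> (v, c) | Some w \<Rightarrow> reduce_column R (v + w, c + nnz_vec w))"
  unfolding reduce_column_def by (subst while_unfold) (auto split: option.splits simp: Let_def)

lemma reduce_column_terminates:
  assumes "\<forall>w\<in>set R. dim_vec w = m" "dim_vec v = m"
  shows "dim_vec (fst (reduce_column R (v, c))) = m"
    and "find_reducer R (fst (reduce_column R (v, c))) = None"
proof -
  have "dim_vec (fst (reduce_column R (v, c))) = m \<and>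
        find_reducer R (fst (reduce_column R (v, c))) = None"
    using assms(2)
  proof (induction "if v = 0\<^sub>v (dim_vec v) then 0 else Suc (low v)" arbitrary: v c rule: less_induct)
    case less
    show ?case
    proof (cases "find_reducer R v")
      case None
      then show ?thesis using less.prems by (subst (1 2) reduce_column_unfold) auto
    next
      case (Some w)
      note w = find_reducerD[OF Some]
      have d: "dim_vec w = m" using w assms(1) by auto
      have "(if v + w = 0\<^sub>v (dim_vec (v + w)) then 0 else Suc (low (v + w)))
            < (if v = 0\<^sub>v (dim_vec v) then 0 else Suc (low v))"
        using low_add_less[of v w] w d less.prems by auto
      from less.hyps[OF this, of "c + nnz_vec w"] d
      show ?thesis by (subst (1 2) reduce_column_unfold) (simp add: Some)
    qed
  qed
  then show "dim_vec (fst (reduce_column R (v, c))) = m"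
    and "find_reducer R (fst (reduce_column R (v, c))) = None" by auto
qed

lemma matrix_reduction_distinct_pivots:
  defines "distinct_pivots \<equiv>
    \<lambda>R. sorted_wrt (\<lambda>u v. u = 0\<^sub>v (dim_vec u) \<or> v = 0\<^sub>v (dim_vec v) \<or> low u \<noteq> low v) R"
  shows "distinct_pivots (fst (matrix_reduction M))"
    and "length (fst (matrix_reduction M)) = dim_col M"
    and "\<forall>v\<in>set (fst (matrix_reduction M)). dim_vec v = dim_row M"
proof -
  let ?f = "\<lambda>(R, c) v. let (v', c') = reduce_column R (v, c) in (R @ [v'], c')"
  have "distinct_pivots (fst (foldl ?f ([], 0) vs)) \<and> length (fst (foldl ?f ([], 0) vs)) = length vs
      \<and> (\<forall>v\<in>set (fst (foldl ?f ([], 0) vs)). dim_vec v = dim_row M)"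
    if "set vs \<subseteq> set (cols M)" for vs
    using that
  proof (induction vs rule: rev_induct)
    case Nil
    then show ?case by (simp add: distinct_pivots_def)
  next
    case (snoc v vs)
    obtain R c where Rc: "foldl ?f ([], 0) vs = (R, c)" by fastforce
    obtain v' c' where v': "reduce_column R (v, c) = (v', c')" by fastforce
    have IH: "distinct_pivots R" "length R = length vs" "\<forall>w\<in>set R. dim_vec w = dim_row M"
      using snoc Rc by auto
    have "dim_vec v = dim_row M" using snoc.prems by (auto simp: cols_def)
    from reduce_column_terminates[OF IH(3) this, of c]
    have "dim_vec v' = dim_row M" "find_reducer R v' = None" by (auto simp: v')
    moreover have "foldl ?f ([], 0) (vs @ [v]) = (R @ [v'], c')"
      by (subst foldl_append, subst Rc) (simp add: v')
    ultimately show ?case using IH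
      by (auto simp: distinct_pivots_def sorted_wrt_append find_reducer_None_iff)
  qed
  from this[of "cols M"] show "distinct_pivots (fst (matrix_reduction M))"
    and "length (fst (matrix_reduction M)) = dim_col M"
    and "\<forall>v\<in>set (fst (matrix_reduction M)). dim_vec v = dim_row M"
    by (simp_all add: matrix_reduction_def)
qed

section \<open>The Cech filtration and its boundary matrices\<close>

text \<open>A configuration of \<open>n\<close> points is a map \<open>X\<close> whose values at the indices \<open>{..<n}\<close> are the
  points. A simplex is represented by the set of the indices of its vertices.\<close>

definition cech_complex :: "nat \<Rightarrow> (nat \<Rightarrow> 'a::metric_space) \<Rightarrow> real \<Rightarrow> nat set set" where
  "cech_complex n X \<alpha> = {\<sigma>. \<sigma> \<noteq> {} \<and> \<sigma> \<subseteq> {..<n} \<and> (\<Inter>p\<in>\<sigma>. cball (X p) \<alpha>) \<noteq> {}}"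

text \<open>For simplices on the indices \<open>{..<n}\<close> the infimum is attained in Euclidean space and does not
  depend on \<open>n\<close> (\<open>entrance_time_smallest\<close> below).\<close>
definition entrance_time :: "(nat \<Rightarrow> 'a::metric_space) \<Rightarrow> nat set \<Rightarrow> real" where
  "entrance_time X \<sigma> = Inf {\<alpha>. (\<Inter>p\<in>\<sigma>. cball (X p) \<alpha>) \<noteq> {}}"

text \<open>The simplices of the filtration are those occurring at some scale.\<close>
definition cech_simplices :: "nat \<Rightarrow> (nat \<Rightarrow> 'a::metric_space) \<Rightarrow> nat \<Rightarrow> nat set set" where
  "cech_simplices n X k = {\<sigma>. (\<exists>\<alpha>. \<sigma> \<in> cech_complex n X \<alpha>) \<and> card \<sigma> = k + 1}"

text \<open>The lexicographic comparison is that of the increasing sequences of vertex indices.\<close>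
definition rho_lex_less :: "(nat \<Rightarrow> 'a::metric_space) \<Rightarrow> nat set \<Rightarrow> nat set \<Rightarrow> bool" where
  "rho_lex_less X \<sigma> \<tau> \<longleftrightarrow>
     entrance_time X \<sigma> < entrance_time X \<tau> \<or>
     entrance_time X \<sigma> = entrance_time X \<tau> \<and>
       (card \<sigma> < card \<tau> \<or>
        card \<sigma> = card \<tau> \<and>
          (sorted_list_of_set \<sigma>, sorted_list_of_set \<tau>) \<in> lexord {(i, j). i < j})"

text \<open>Existence and uniqueness of the list: \<open>rho_lex_list_eqI\<close> and \<open>rho_lex_list_props\<close> below.\<close>
definition rho_lex_list :: "nat \<Rightarrow> (nat \<Rightarrow> 'a::metric_space) \<Rightarrow> nat \<Rightarrow> nat set list" where
  "rho_lex_list n X k =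
     (THE xs. set xs = cech_simplices n X k \<and> sorted_wrt (rho_lex_less X) xs)"

definition facet :: "nat set \<Rightarrow> nat set \<Rightarrow> bool" where
  "facet \<sigma> \<tau> \<longleftrightarrow> \<sigma> \<subseteq> \<tau> \<and> card \<tau> = card \<sigma> + 1"

definition boundary_matrix :: "nat set list \<Rightarrow> nat set list \<Rightarrow> bit mat" where
  "boundary_matrix rs cs =
     mat (length rs) (length cs) (\<lambda>(i, j). if facet (rs ! i) (cs ! j) then 1 else 0)"

definition cech_boundary_matrix :: "nat \<Rightarrow> (nat \<Rightarrow> 'a::metric_space) \<Rightarrow> nat \<Rightarrow> bit mat" where
  "cech_boundary_matrix n X k = boundary_matrix (rho_lex_list n X k) (rho_lex_list n X (k + 1))"

section \<open>Independent uniform points in the unit cube\<close>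

definition unit_cube :: "(real ^ 'd) set" where
  "unit_cube = cbox (\<chi> i. - 1 / 2) (\<chi> i. 1 / 2)"

definition uniform_points :: "nat \<Rightarrow> (nat \<Rightarrow> real ^ 'd) measure" where
  "uniform_points n = Pi\<^sub>M {..<n} (\<lambda>_. uniform_measure lborel unit_cube)"

section \<open>Well-definedness\<close>

lemma cech_cover_iff:
  "(\<Inter>p\<in>\<sigma>. cball (X p) \<alpha>) \<noteq> {} \<longleftrightarrow> (\<exists>c. \<forall>p\<in>\<sigma>. dist (X p) c \<le> \<alpha>)"
  by (auto simp: set_eq_iff)

lemma ex_cech_cover:
  assumes "finite \<sigma>" "\<sigma> \<noteq> {}"
  shows "\<exists>\<alpha>. (\<Inter>p\<in>\<sigma>. cball (X p) \<alpha>) \<noteq> {}"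
proof -
  obtain q where "q \<in> \<sigma>" using assms by auto
  have "\<forall>p\<in>\<sigma>. dist (X p) (X q) \<le> Max ((\<lambda>p. dist (X p) (X q)) ` \<sigma>)"
    using assms by (auto intro: Max_ge)
  then show ?thesis unfolding cech_cover_iff by blast
qed

lemma cech_simplices_eq: "cech_simplices n X k = {\<sigma>. \<sigma> \<subseteq> {..<n} \<and> card \<sigma> = k + 1}"
proof -
  have "\<exists>\<alpha>. \<sigma> \<in> cech_complex n X \<alpha>" if "\<sigma> \<subseteq> {..<n}" "card \<sigma> = k + 1" for \<sigma>
  proof -
    from that have "finite \<sigma>" "\<sigma> \<noteq> {}" by (auto intro: finite_subset)
    from ex_cech_cover[OF this, of X] that \<open>\<sigma> \<noteq> {}\<close> show ?thesis
      by (auto simp: cech_complex_def)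
  qed
  then show ?thesis by (auto simp: cech_simplices_def cech_complex_def)
qed

lemma finite_cech_simplices: "finite (cech_simplices n X k)"
  unfolding cech_simplices_eq by auto

lemma cech_cover_closed:
  fixes X :: "nat \<Rightarrow> 'a::heine_borel"
  assumes "finite \<sigma>" "\<sigma> \<noteq> {}"
  shows "(\<Inter>p\<in>\<sigma>. cball (X p) (entrance_time X \<sigma>)) \<noteq> {}"
    and "\<And>\<alpha>. (\<Inter>p\<in>\<sigma>. cball (X p) \<alpha>) \<noteq> {} \<Longrightarrow> entrance_time X \<sigma> \<le> \<alpha>"
proof -
  let ?A = "{\<alpha>. (\<Inter>p\<in>\<sigma>. cball (X p) \<alpha>) \<noteq> {}}"
  obtain q where q: "q \<in> \<sigma>" using assms by auto
  have bdd: "bdd_below ?A"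
  proof (rule bdd_belowI[of _ 0])
    fix \<alpha> assume "\<alpha> \<in> ?A"
    then obtain c where "dist (X q) c \<le> \<alpha>" using q by (auto simp: cech_cover_iff)
    then show "0 \<le> \<alpha>" using zero_le_dist[of "X q" c] by linarith
  qed
  have ne: "?A \<noteq> {}" using ex_cech_cover[OF assms] by auto
  show low: "entrance_time X \<sigma> \<le> \<alpha>" if "(\<Inter>p\<in>\<sigma>. cball (X p) \<alpha>) \<noteq> {}" for \<alpha>
    unfolding entrance_time_def using that bdd by (intro cInf_lower) auto
  let ?K = "\<lambda>i::nat. \<Inter>p\<in>\<sigma>. cball (X p) (entrance_time X \<sigma> + 1 / real (Suc i))"
  have K_ne: "?K i \<noteq> {}" for i
  proof -
    have "Inf ?A < entrance_time X \<sigma> + 1 / real (Suc i)" by (simp add: entrance_time_def)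
    then obtain \<alpha> where \<alpha>: "\<alpha> \<in> ?A" "\<alpha> < entrance_time X \<sigma> + 1 / real (Suc i)"
      using cInf_lessD[OF ne] by blast
    then obtain c where "\<forall>p\<in>\<sigma>. dist (X p) c \<le> \<alpha>" by (auto simp: cech_cover_iff)
    with \<alpha>(2) have "\<forall>p\<in>\<sigma>. dist (X p) c \<le> entrance_time X \<sigma> + 1 / real (Suc i)" by force
    then show ?thesis unfolding cech_cover_iff by blast
  qed
  have "\<Inter>(range ?K) \<noteq> {}"
  proof (rule compact_nest)
    fix i
    have "bounded (?K i)"
      by (rule bounded_subset[OF bounded_cball[of "X q" "entrance_time X \<sigma> + 1 / real (Suc i)"]])
        (use q in auto)
    then show "compact (?K i)" by (auto simp: compact_eq_bounded_closed intro!: closed_INT)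
    show "?K i \<noteq> {}" by (rule K_ne)
  next
    fix i j :: nat assume "i \<le> j"
    then have "1 / real (Suc j) \<le> 1 / real (Suc i)" by (simp add: frac_le)
    then show "?K j \<subseteq> ?K i" by fastforce
  qed
  then obtain c where "c \<in> \<Inter>(range ?K)" by (meson ex_in_conv)
  then have c: "dist (X p) c \<le> entrance_time X \<sigma> + 1 / real (Suc i)" if "p \<in> \<sigma>" for i p
    using that by (auto simp del: of_nat_Suc)
  have "dist (X p) c \<le> entrance_time X \<sigma>" if "p \<in> \<sigma>" for p
  proof (rule field_le_epsilon)
    fix e :: real assume "0 < e"
    then obtain i where "1 / real (Suc i) < e" using nat_approx_posE by (metis)
    with c[OF that, of i] show "dist (X p) c \<le> entrance_time X \<sigma> + e" by linarith
  qed
  then show "(\<Inter>p\<in>\<sigma>. cball (X p) (entrance_time X \<sigma>)) \<noteq> {}"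
    unfolding cech_cover_iff by blast
qed

lemma entrance_time_smallest:
  fixes X :: "nat \<Rightarrow> 'a::heine_borel"
  assumes "\<sigma> \<noteq> {}" "\<sigma> \<subseteq> {..<n}"
  shows "\<sigma> \<in> cech_complex n X (entrance_time X \<sigma>)"
    and "\<And>\<alpha>. \<sigma> \<in> cech_complex n X \<alpha> \<Longrightarrow> entrance_time X \<sigma> \<le> \<alpha>"
proof -
  have f: "finite \<sigma>" using assms finite_subset by blast
  show "\<sigma> \<in> cech_complex n X (entrance_time X \<sigma>)"
    using cech_cover_closed(1)[OF f assms(1)] assms by (auto simp: cech_complex_def)
  show "entrance_time X \<sigma> \<le> \<alpha>" if "\<sigma> \<in> cech_complex n X \<alpha>" for \<alpha>
    using cech_cover_closed(2)[OF f assms(1)] that by (auto simp: cech_complex_def)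
qed

lemma rho_lex_less_irrefl: "\<not> rho_lex_less X \<sigma> \<sigma>"
  by (auto simp: rho_lex_less_def lexord_irreflexive)

lemma rho_lex_less_trans:
  assumes "rho_lex_less X \<sigma> \<tau>" "rho_lex_less X \<tau> \<upsilon>"
  shows "rho_lex_less X \<sigma> \<upsilon>"
proof -
  have "(a, c) \<in> lexord {(i::nat, j). i < j}"
    if "(a, b) \<in> lexord {(i, j). i < j}" "(b, c) \<in> lexord {(i, j). i < j}" for a b c
    by (rule lexord_trans[OF that]) (auto intro: transI)
  with assms show ?thesis unfolding rho_lex_less_def by (smt (verit) order.strict_trans)
qed

lemma rho_lex_less_total:
  assumes "finite \<sigma>" "finite \<tau>" "\<sigma> \<noteq> \<tau>"
  shows "rho_lex_less X \<sigma> \<tau> \<or> rho_lex_less X \<tau> \<sigma>"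
proof -
  have "sorted_list_of_set \<sigma> \<noteq> sorted_list_of_set \<tau>"
    using assms by (metis set_sorted_list_of_set)
  then have "(sorted_list_of_set \<sigma>, sorted_list_of_set \<tau>) \<in> lexord {(i, j). i < j} \<or>
        (sorted_list_of_set \<tau>, sorted_list_of_set \<sigma>) \<in> lexord {(i, j). i < j}"
    using lexord_linear[of "{(i::nat, j). i < j}" "sorted_list_of_set \<sigma>" "sorted_list_of_set \<tau>"]
    by (auto simp: linorder_less_linear)
  then show ?thesis unfolding rho_lex_less_def by auto
qed

lemma sorted_wrt_unique:
  assumes irr: "\<And>x. \<not> P x x" and tr: "\<And>x y z. P x y \<Longrightarrow> P y z \<Longrightarrow> P x z"
  shows "sorted_wrt P xs \<Longrightarrow> sorted_wrt P ys \<Longrightarrow> set xs = set ys \<Longrightarrow> xs = ys"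
proof (induction xs arbitrary: ys)
  case Nil
  then show ?case by simp
next
  case (Cons x xs)
  then obtain y ys' where ys: "ys = y # ys'" by (cases ys) auto
  have "x = y"
  proof (rule ccontr)
    assume "x \<noteq> y"
    then have "x \<in> set ys'" "y \<in> set xs" using Cons.prems(3) ys by auto
    then have "P x y" "P y x" using Cons.prems ys by auto
    then show False using irr tr by blast
  qed
  moreover have "set xs = set ys'"
  proof -
    have "x \<notin> set xs" "y \<notin> set ys'" using Cons.prems ys irr by auto
    then show ?thesis using Cons.prems(3) ys \<open>x = y\<close> by auto
  qed
  ultimately show ?case using Cons.IH[of ys'] Cons.prems ys by auto
qed

lemma ex_sorted_wrt:
  assumes "finite S"
    and tr: "\<And>x y z. P x y \<Longrightarrow> P y z \<Longrightarrow> P x z"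
    and tot: "\<And>x y. x \<in> S \<Longrightarrow> y \<in> S \<Longrightarrow> x \<noteq> y \<Longrightarrow> P x y \<or> P y x"
  shows "\<exists>xs. set xs = S \<and> sorted_wrt P xs"
  using assms(1) tot
proof (induction S rule: finite_induct)
  case empty
  then show ?case by simp
next
  case (insert a S)
  then obtain xs where xs: "set xs = S" "sorted_wrt P xs" by auto
  let ?ys = "filter (\<lambda>b. P b a) xs @ a # filter (\<lambda>b. \<not> P b a) xs"
  have "P a b" if "b \<in> S" "\<not> P b a" for b
    using insert.prems[of a b] insert.hyps that by auto
  then have "sorted_wrt P ?ys"
    using xs tr by (auto simp: sorted_wrt_append sorted_wrt_filter)
  moreover have "set ?ys = insert a S" using xs by auto
  ultimately show ?case by blast
qed

lemma rho_lex_list_eqI: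
  assumes "set xs = cech_simplices n X k" "sorted_wrt (rho_lex_less X) xs"
  shows "rho_lex_list n X k = xs"
  unfolding rho_lex_list_def
proof (rule the_equality)
  fix ys assume "set ys = cech_simplices n X k \<and> sorted_wrt (rho_lex_less X) ys"
  then show "ys = xs"
    using sorted_wrt_unique[of "rho_lex_less X" ys xs] rho_lex_less_irrefl rho_lex_less_trans assms
    by metis
qed (use assms in auto)

lemma rho_lex_list_props:
  shows "set (rho_lex_list n X k) = cech_simplices n X k"
    and "sorted_wrt (rho_lex_less X) (rho_lex_list n X k)"
    and "distinct (rho_lex_list n X k)"
    and "length (rho_lex_list n X k) = n choose (k + 1)"
proof -
  have fin: "finite \<sigma>" if "\<sigma> \<in> cech_simplices n X k" for \<sigma>
    using that by (auto simp: cech_simplices_eq intro: finite_subset)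
  obtain xs where xs: "set xs = cech_simplices n X k" "sorted_wrt (rho_lex_less X) xs"
    using ex_sorted_wrt[of "cech_simplices n X k" "rho_lex_less X"] finite_cech_simplices
      rho_lex_less_trans rho_lex_less_total fin by metis
  note eq = rho_lex_list_eqI[OF xs]
  show s: "set (rho_lex_list n X k) = cech_simplices n X k" using xs eq by simp
  show "sorted_wrt (rho_lex_less X) (rho_lex_list n X k)" using xs eq by simp
  then show d: "distinct (rho_lex_list n X k)"
    unfolding distinct_conv_nth sorted_wrt_iff_nth_less
    using rho_lex_less_irrefl by (metis linorder_neqE_nat)
  have "card {\<sigma>. \<sigma> \<subseteq> {..<n} \<and> card \<sigma> = k + 1} = n choose (k + 1)"
    using n_subsets[of "{..<n}" "k + 1"] by simp
  then show "length (rho_lex_list n X k) = n choose (k + 1)"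
    using distinct_card[OF d] s by (simp add: cech_simplices_eq)
qed

lemma prob_space_uniform_cube:
  "prob_space (uniform_measure lborel (unit_cube :: (real ^ 'd) set))"
proof (rule prob_space_uniform_measure)
  have "emeasure lborel (unit_cube :: (real ^ 'd) set) = 1"
  proof -
    have in1: "((\<chi> i. 1 / 2) - (\<chi> i. - 1 / 2)) \<bullet> b = (1 :: real)"
      and le: "(\<chi> i. - 1 / 2) \<bullet> b \<le> (\<chi> i. 1 / 2) \<bullet> b" if "b \<in> Basis" for b :: "real ^ 'd"
      using that by (auto simp: Basis_vec_def inner_axis)
    show ?thesis
      unfolding unit_cube_def
      by (simp only: emeasure_lborel_cbox[OF le] in1 prod.neutral_const ennreal_1 cong: prod.cong)
  qed
  then show "emeasure lborel (unit_cube :: (real ^ 'd) set) \<noteq> 0"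
    and "emeasure lborel (unit_cube :: (real ^ 'd) set) \<noteq> \<infinity>" by auto
qed

lemma prob_space_uniform_points: "prob_space (uniform_points n)"
  unfolding uniform_points_def by (intro prob_space_PiM prob_space_uniform_cube)

lemma entrance_time_less_iff:
  fixes X :: "nat \<Rightarrow> real ^ 'd"
  assumes "finite \<sigma>" "\<sigma> \<noteq> {}" "D \<subseteq> UNIV" "closure D = UNIV"
  shows "entrance_time X \<sigma> < a \<longleftrightarrow> (\<exists>c\<in>D. \<forall>p\<in>\<sigma>. dist (X p) c < a)"
proof
  assume "entrance_time X \<sigma> < a"
  moreover obtain c where "\<forall>p\<in>\<sigma>. dist (X p) c \<le> entrance_time X \<sigma>"
    using cech_cover_closed(1)[OF assms(1,2), of X] unfolding cech_cover_iff by blast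
  ultimately have c: "\<forall>p\<in>\<sigma>. dist (X p) c < a" by force
  have "open (\<Inter>p\<in>\<sigma>. ball (X p) a)" using assms by (intro open_INT) auto
  moreover have "c \<in> (\<Inter>p\<in>\<sigma>. ball (X p) a)" using c by auto
  moreover have "c \<in> closure D" using assms by simp
  ultimately obtain c' where "c' \<in> D" "c' \<in> (\<Inter>p\<in>\<sigma>. ball (X p) a)"
    by (meson IntE closure_iff_nhds_not_empty disjoint_iff subset_refl)
  then show "\<exists>c\<in>D. \<forall>p\<in>\<sigma>. dist (X p) c < a" by auto
next
  assume "\<exists>c\<in>D. \<forall>p\<in>\<sigma>. dist (X p) c < a"
  then obtain c where c: "\<forall>p\<in>\<sigma>. dist (X p) c < a" by blast
  let ?m = "Max ((\<lambda>p. dist (X p) c) ` \<sigma>)"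
  have "\<forall>p\<in>\<sigma>. dist (X p) c \<le> ?m" using assms by (auto intro: Max_ge)
  then have "entrance_time X \<sigma> \<le> ?m"
    using cech_cover_closed(2)[OF assms(1,2), of X] unfolding cech_cover_iff by blast
  also have "?m < a" using c assms by (subst Max_less_iff) auto
  finally show "entrance_time X \<sigma> < a" .
qed

lemma measurable_entrance_time:
  assumes "\<sigma> \<subseteq> {..<n}" "\<sigma> \<noteq> {}"
  shows "(\<lambda>X. entrance_time X \<sigma>) \<in> borel_measurable (uniform_points n :: (nat \<Rightarrow> real ^ 'd) measure)"
proof -
  let ?M = "uniform_points n :: (nat \<Rightarrow> real ^ 'd) measure"
  have fin: "finite \<sigma>" using assms finite_subset by blast
  obtain D :: "(real ^ 'd) set" where D: "countable D" "closure D = UNIV"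
    using separable[of "UNIV :: (real ^ 'd) set"] by (metis UNIV_I subset_antisym subsetI)
  have comp: "(\<lambda>X. X p) \<in> borel_measurable ?M" if "p \<in> \<sigma>" for p
  proof -
    have "(\<lambda>X. X p) \<in> measurable ?M (uniform_measure lborel unit_cube)"
      unfolding uniform_points_def using that assms by (intro measurable_component_singleton) auto
    then show ?thesis by (simp cong: measurable_cong_sets)
  qed
  show ?thesis
  proof (rule borel_measurableI_less)
    fix a
    have "{X \<in> space ?M. \<exists>c\<in>D. \<forall>p\<in>\<sigma>. dist (X p) c < a} \<in> sets ?M"
    proof (intro sets.sets_Collect_countable_Ex' sets.sets_Collect_finite_All D fin)
      fix c p assume "p \<in> \<sigma>"
      note [measurable] = comp[OF this]
      show "{X \<in> space ?M. dist (X p) c < a} \<in> sets ?M" by measurable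
    qed
    then show "{X \<in> space ?M. entrance_time X \<sigma> < a} \<in> sets ?M"
      by (simp add: entrance_time_less_iff[OF fin assms(2) _ D(2)])
  qed
qed

definition entrance_pattern :: "nat \<Rightarrow> (nat \<Rightarrow> 'a::metric_space) \<Rightarrow> (nat set \<times> nat set) set" where
  "entrance_pattern n X =
     {(\<sigma>, \<tau>) \<in> (Pow {..<n} - {{}}) \<times> (Pow {..<n} - {{}}). entrance_time X \<sigma> < entrance_time X \<tau>}"

lemma rho_lex_list_cong:
  assumes "entrance_pattern n X = entrance_pattern n Y"
  shows "rho_lex_list n X k = rho_lex_list n Y k"
proof -
  have lt: "entrance_time X \<sigma> < entrance_time X \<tau> \<longleftrightarrow> entrance_time Y \<sigma> < entrance_time Y \<tau>"
    if "\<sigma> \<in> cech_simplices n X k" "\<tau> \<in> cech_simplices n X k" for \<sigma> \<tau>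
  proof -
    have "(\<sigma>, \<tau>) \<in> entrance_pattern n X \<longleftrightarrow> (\<sigma>, \<tau>) \<in> entrance_pattern n Y" using assms by simp
    moreover have "\<sigma> \<noteq> {}" "\<tau> \<noteq> {}" using that by (auto simp: cech_simplices_eq)
    ultimately show ?thesis using that by (simp add: entrance_pattern_def cech_simplices_eq)
  qed
  have rl: "rho_lex_less X \<sigma> \<tau> \<longleftrightarrow> rho_lex_less Y \<sigma> \<tau>"
    if "\<sigma> \<in> cech_simplices n X k" "\<tau> \<in> cech_simplices n X k" for \<sigma> \<tau>
    using lt[OF that] lt[OF that(2) that(1)] unfolding rho_lex_less_def by auto
  have "cech_simplices n X k = cech_simplices n Y k" by (simp add: cech_simplices_eq)
  moreover have "sorted_wrt (rho_lex_less Y) (rho_lex_list n X k)"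
  proof (rule sorted_wrt_mono_rel)
    show "sorted_wrt (rho_lex_less X) (rho_lex_list n X k)" by (rule rho_lex_list_props(2))
  qed (use rl rho_lex_list_props(1)[of n X k] in auto)
  ultimately show ?thesis using rho_lex_list_props(1)[of n X k] rho_lex_list_eqI by metis
qed

text \<open>Every function of the boundary matrix is integrable, so that expectations of fill-in and cost
  are not affected by the default value of the Bochner integral.\<close>
lemma integrable_cech_boundary_matrix:
  fixes f :: "bit mat \<Rightarrow> real"
  shows "integrable (uniform_points n :: (nat \<Rightarrow> real ^ 'd) measure)
           (\<lambda>X. f (cech_boundary_matrix n X k))"
proof -
  let ?M = "uniform_points n :: (nat \<Rightarrow> real ^ 'd) measure"
  interpret prob_space ?M by (rule prob_space_uniform_points)
  let ?S = "Pow {..<n} - {{}}"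
  let ?A = "Pow (?S \<times> ?S)"
  let ?g = "\<lambda>X. f (cech_boundary_matrix n (X :: nat \<Rightarrow> real ^ 'd) k)"
  define F where "F P = ?g (SOME X. entrance_pattern n X = P)" for P
  have gF: "?g X = F (entrance_pattern n X)" for X
  proof -
    let ?Y = "SOME Y :: nat \<Rightarrow> real ^ 'd. entrance_pattern n Y = entrance_pattern n X"
    have "entrance_pattern n ?Y = entrance_pattern n X" 
      by (rule someI[of "\<lambda>Y. entrance_pattern n Y = entrance_pattern n X" X]) simp
    then have "cech_boundary_matrix n ?Y k = cech_boundary_matrix n X k"
      by (simp add: cech_boundary_matrix_def rho_lex_list_cong[of n ?Y X])
    then show ?thesis by (simp add: F_def)
  qed
  have finA: "finite ?A" by simp
  have pm: "entrance_pattern n \<in> measurable ?M (count_space ?A)"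
  proof (subst measurable_count_space_eq2[OF finA], intro conjI ballI)
    show "entrance_pattern n \<in> space ?M \<rightarrow> ?A" by (auto simp: entrance_pattern_def)
    fix P assume P: "P \<in> ?A"
    have "{X \<in> space ?M. \<forall>z\<in>?S \<times> ?S. z \<in> P \<longleftrightarrow>
              entrance_time X (fst z) < entrance_time X (snd z)} \<in> sets ?M"
    proof (intro sets.sets_Collect_finite_All)
      fix z assume "z \<in> ?S \<times> ?S"
      then have [measurable]: "(\<lambda>X. entrance_time X (fst z)) \<in> borel_measurable ?M"
        "(\<lambda>X. entrance_time X (snd z)) \<in> borel_measurable ?M"
        by (auto intro!: measurable_entrance_time)
      show "{X \<in> space ?M. z \<in> P \<longleftrightarrow>
              entrance_time X (fst z) < entrance_time X (snd z)} \<in> sets ?M"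
        by measurable
    qed simp
    moreover have "entrance_pattern n -` {P} \<inter> space ?M = {X \<in> space ?M. \<forall>z\<in>?S \<times> ?S. z \<in> P \<longleftrightarrow>
              entrance_time X (fst z) < entrance_time X (snd z)}"
    proof -
      have "entrance_pattern n X = P \<longleftrightarrow>
          (\<forall>z\<in>?S \<times> ?S. z \<in> P \<longleftrightarrow> entrance_time X (fst z) < entrance_time X (snd z))"
        for X :: "nat \<Rightarrow> real ^ 'd"
      proof -
        have "entrance_pattern n X =
            {z \<in> ?S \<times> ?S. entrance_time X (fst z) < entrance_time X (snd z)}"
          unfolding entrance_pattern_def by auto
        moreover have "P \<subseteq> ?S \<times> ?S" using P by (rule PowD)
        ultimately show ?thesis by (simp only:) blast
      qed
      then show ?thesis by auto
    qed
    ultimately show "entrance_pattern n -` {P} \<inter> space ?M \<in> sets ?M" by simp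
  qed
  have meas: "?g \<in> borel_measurable ?M"
    unfolding gF by (rule measurable_compose[OF pm]) simp
  have "AE X in ?M. norm (?g X) \<le> Max ((\<lambda>P. norm (F P)) ` ?A)"
    unfolding gF
    by (intro AE_I2 Max_ge finite_imageI finA imageI) (auto simp: entrance_pattern_def)
  then show ?thesis using meas by (rule integrable_const_bound)
qed

end

theory Submission
  imports Defs "HOL-Real_Asymp.Real_Asymp"
begin

text \<open>
  Why the bounds hold. Let \<open>\<rho>\<close> be the entrance time. Call a \<open>k\<close>-simplex \<open>\<sigma>\<close> \<^emph>\<open>empty\<close> if adding any
  further point strictly increases \<open>\<rho>\<close>, i.e. if the smallest enclosing ball of \<open>\<sigma>\<close> contains no
  sample point outside \<open>\<sigma>\<close>.

  The combinatorial core is \<open>pivot_dichotomy\<close>: a non-zero column of the reduced matrix has at most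
  \<open>k + 2\<close> entries or its pivot is an empty simplex. If the pivot \<open>\<sigma>\<close> is not empty, let \<open>v\<close> be the
  smallest vertex in its enclosing ball outside \<open>\<sigma>\<close>. The lexicographic tie-breaking makes
  \<open>\<sigma> \<union> {v}\<close> the first coface of \<open>\<sigma>\<close>. Either \<open>\<sigma>\<close> is its last facet; then its column has pivot \<open>\<sigma>\<close>
  from the start, no earlier column touches row \<open>\<sigma>\<close>, and the column is never changed. Or \<open>\<sigma>\<close>
  contains a vertex \<open>x < v\<close> such that \<open>\<sigma>\<close> is the first coface of \<open>\<sigma> - {x}\<close>; then \<open>\<sigma>\<close> cannot be a
  pivot, because a reduced column is a cycle, and its boundary would have the entry 1 at
  \<open>\<sigma> - {x}\<close>. The second case needs the points to be generic, in the sense that of the vertices on the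
  enclosing ball none can be traded for another; this holds almost surely, as the exceptional
  configurations put a point on a sphere that is determined by other points
  (\<open>AE_generic_points\<close>).

  Pivots of distinct columns are distinct and a column has no entry below its pivot. So if every
  empty \<open>k\<close>-simplex has \<open>\<rho> \<le> r\<close> and \<open>N\<close> simplices of dimension \<open>k\<close> have \<open>\<rho> \<le> r\<close>, then the fill-in is
  at most \<open>(k + 2) * n ^ (k + 1) + N\<^sup>2\<close> (\<open>fill_in_bound\<close>). The first term belongs to the short columns,
  the second one to the columns with empty pivot.

  To find \<open>r\<close> and \<open>N\<close>, cut the cube into about \<open>n / ln n\<close> congruent cells. With overwhelming
  probability each cell contains more than \<open>k + 1\<close> points, so a ball with centre in the cube that is
  as large as a cell contains further points, and empty simplices are not larger than a cell. Also with
  overwhelming probability each block of boundedly many cells contains \<open>O(ln n)\<close> points, so that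
  \<open>N = O(n * ln n ^ k)\<close>. Both are union bounds over cells and over sets of points. The exceptional
  event is so unlikely that the trivial bound \<open>n ^ (2 * k + 2)\<close> contributes only
  \<open>O(n ^ (k + 1))\<close> to the expectation. Together this gives
  \<open>O(n\<^sup>2 * ln n ^ (2 * k) + n ^ (k + 1))\<close>.

  For the cost, note that the reduction of one column adds each earlier column at most once,
  because the pivot strictly decreases. So it costs at most the total fill-in, and there are at most
  \<open>n ^ (k + 2)\<close> columns (\<open>reduction_cost_le_fill_in\<close>).
\<close>

section \<open>Invariants and cost of matrix reduction\<close>

definition reduction_step :: "bit vec list \<times> nat \<Rightarrow> bit vec \<Rightarrow> bit vec list \<times> nat" where
  "reduction_step = (\<lambda>(R, c) v. let (v', c') = reduce_column R (v, c) in (R @ [v'], c'))"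

abbreviation reduced_cols :: "bit mat \<Rightarrow> bit vec list" where
  "reduced_cols M \<equiv> fst (matrix_reduction M)"

lemma matrix_reduction_eq: "matrix_reduction M = foldl reduction_step ([], 0) (cols M)"
  by (simp add: matrix_reduction_def reduction_step_def)

lemma reduction_step_snoc:
  "foldl reduction_step s (vs @ [v]) =
     (let (R, c) = foldl reduction_step s vs; (v', c') = reduce_column R (v, c) in (R @ [v'], c'))"
  by (simp add: reduction_step_def case_prod_beta Let_def)

text \<open>Induction along the loop that reduces one column. It terminates because the pivot strictly
  decreases; the step provides this fact, which also bounds the cost.\<close>

lemma reduce_column_induct:
  assumes dims: "\<forall>w\<in>set R. dim_vec w = m" "dim_vec v = m"
    and stop: "\<And>v c. find_reducer R v = None \<Longrightarrow> dim_vec v = m \<Longrightarrow> P v c (v, c)"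
    and step: "\<And>v c w s. find_reducer R v = Some w \<Longrightarrow> dim_vec v = m \<Longrightarrow> dim_vec w = m \<Longrightarrow>
        v + w = 0\<^sub>v m \<or> low (v + w) < low v \<Longrightarrow>
        P (v + w) (c + nnz_vec w) s \<Longrightarrow> P v c s"
  shows "P v c (reduce_column R (v, c))"
  using dims(2)
proof (induction "if v = 0\<^sub>v (dim_vec v) then 0 else Suc (low v)" arbitrary: v c rule: less_induct)
  case less
  show ?case
  proof (cases "find_reducer R v")
    case None
    with stop[OF None less.prems] show ?thesis by (subst reduce_column_unfold) simp
  next
    case (Some w)
    note w = find_reducerD[OF Some]
    have d: "dim_vec w = m" using w dims(1) by auto
    have l: "v + w = 0\<^sub>v m \<or> low (v + w) < low v"
      using low_add_less[of v w] w d less.prems by auto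
    then have "(if v + w = 0\<^sub>v (dim_vec (v + w)) then 0 else Suc (low (v + w)))
          < (if v = 0\<^sub>v (dim_vec v) then 0 else Suc (low v))"
      using w d by auto
    from less.hyps[OF this, of "c + nnz_vec w"] d
    have "P (v + w) (c + nnz_vec w) (reduce_column R (v + w, c + nnz_vec w))" by simp
    from step[OF Some less.prems d l this] show ?thesis
      by (subst reduce_column_unfold) (simp add: Some)
  qed
qed

text \<open>A property that is preserved by addition passes from the columns to the reduced columns; this
  replaces any explicit description of reduced columns as linear combinations.\<close>

lemma reduce_column_closed:
  assumes "\<forall>w\<in>set R. dim_vec w = m \<and> Q w" "dim_vec v = m" "Q v"
    and add: "\<And>u w. dim_vec u = m \<Longrightarrow> dim_vec w = m \<Longrightarrow> Q u \<Longrightarrow> Q w \<Longrightarrow> Q (u + w)"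
  shows "Q (fst (reduce_column R (v, c)))"
proof -
  have "Q v \<longrightarrow> Q (fst (reduce_column R (v, c)))"
  proof (rule reduce_column_induct[where P = "\<lambda>v c s. Q v \<longrightarrow> Q (fst s)" and m = m])
    fix v c w and s :: "bit vec \<times> nat"
    assume "find_reducer R v = Some w" "dim_vec v = m" "dim_vec w = m"
      "Q (v + w) \<longrightarrow> Q (fst s)"
    with find_reducerD(1) assms(1) add[of v w] show "Q v \<longrightarrow> Q (fst s)" by blast
  qed (use assms in auto)
  with assms show ?thesis by simp
qed

text \<open>Here \<open>f\<close> stands for the costs that are still possible before \<open>w\<close> is paid for and \<open>g\<close> for those
  that remain afterwards.\<close>

lemma sum_list_add_member_le:
  fixes f g :: "'b \<Rightarrow> nat"
  assumes "w \<in> set R" "\<And>x. x \<in> set R \<Longrightarrow> g x \<le> f x" "g w = 0"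
  shows "f w + (\<Sum>x\<leftarrow>R. g x) \<le> (\<Sum>x\<leftarrow>R. f x)"
proof -
  obtain as bs where R: "R = as @ w # bs" using assms(1) split_list by metis
  have "(\<Sum>x\<leftarrow>as. g x) \<le> (\<Sum>x\<leftarrow>as. f x)" "(\<Sum>x\<leftarrow>bs. g x) \<le> (\<Sum>x\<leftarrow>bs. f x)"
    using assms(2) R by (auto intro!: sum_list_mono)
  then show ?thesis using assms(3) R by simp
qed

text \<open>Each reduced column is added at most once: after its addition the pivot is smaller than its own
  pivot, so that it is never selected again. The invariant keeps as budget the columns whose
  pivot does not exceed the current one.\<close>

lemma reduce_column_cost:
  assumes "\<forall>w\<in>set R. dim_vec w = m" "dim_vec v = m"
  shows "snd (reduce_column R (v, c)) \<le> c + (\<Sum>w\<leftarrow>R. nnz_vec w)"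
proof -
  let ?g = "\<lambda>v w. if v \<noteq> 0\<^sub>v m \<and> w \<noteq> 0\<^sub>v m \<and> low w \<le> low v then nnz_vec w else 0"
  have "snd (reduce_column R (v, c)) \<le> c + (\<Sum>w\<leftarrow>R. ?g v w)"
  proof (rule reduce_column_induct[where m = m and R = R
        and P = "\<lambda>v c s. snd s \<le> c + (\<Sum>w\<leftarrow>R. ?g v w)"])
    fix v c w and s :: "bit vec \<times> nat"
    assume a: "find_reducer R v = Some w" "dim_vec v = m" "dim_vec w = m"
      and l: "v + w = 0\<^sub>v m \<or> low (v + w) < low v"
      and IH: "snd s \<le> c + nnz_vec w + (\<Sum>x\<leftarrow>R. ?g (v + w) x)"
    note w = find_reducerD[OF a(1)]
    have "?g v w + (\<Sum>x\<leftarrow>R. ?g (v + w) x) \<le> (\<Sum>x\<leftarrow>R. ?g v x)"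
      using w a l by (intro sum_list_add_member_le) auto
    moreover have "?g v w = nnz_vec w" using w a by simp
    ultimately show "snd s \<le> c + (\<Sum>x\<leftarrow>R. ?g v x)" using IH by linarith
  qed (use assms in auto)
  also have "(\<Sum>w\<leftarrow>R. ?g v w) \<le> (\<Sum>w\<leftarrow>R. nnz_vec w)"
    by (rule sum_list_mono) auto
  finally show ?thesis by simp
qed

lemma reduction_prefix:
  assumes "set vs \<subseteq> carrier_vec m" "foldl reduction_step ([], 0) vs = (R, c)"
  shows "length R = length vs \<and> set R \<subseteq> carrier_vec m \<and>
    (\<forall>j<length vs. \<exists>c. R ! j = fst (reduce_column (take j R) (vs ! j, c))) \<and>
    c \<le> length vs * (\<Sum>w\<leftarrow>R. nnz_vec w)"
  using assms
proof (induction vs arbitrary: R c rule: rev_induct)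
  case Nil
  then show ?case by simp
next
  case (snoc v vs)
  obtain R0 c0 where 0: "foldl reduction_step ([], 0) vs = (R0, c0)" by fastforce
  obtain v' c' where v': "reduce_column R0 (v, c0) = (v', c')" by fastforce
  have R: "R = R0 @ [v']" "c = c'"
    using snoc.prems(2) by (simp_all only: reduction_step_snoc 0 v' Let_def split) auto
  have IH: "length R0 = length vs" "set R0 \<subseteq> carrier_vec m"
     "\<forall>j<length vs. \<exists>c. R0 ! j = fst (reduce_column (take j R0) (vs ! j, c))"
     "c0 \<le> length vs * (\<Sum>w\<leftarrow>R0. nnz_vec w)"
    using snoc.IH[OF _ 0] snoc.prems by auto
  have dims: "\<forall>w\<in>set R0. dim_vec w = m" "dim_vec v = m" using IH snoc.prems by auto
  have "dim_vec v' = m" using reduce_column_terminates(1)[OF dims, of c0] v' by simp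
  moreover have "c' \<le> length vs * (\<Sum>w\<leftarrow>R0. nnz_vec w) + (\<Sum>w\<leftarrow>R0. nnz_vec w)"
    using reduce_column_cost[OF dims, of c0] IH(4) v' by simp
  moreover have "\<dots> \<le> length (vs @ [v]) * (\<Sum>w\<leftarrow>R. nnz_vec w)" by (simp add: R algebra_simps)
  moreover have "\<exists>c. R ! j = fst (reduce_column (take j R) ((vs @ [v]) ! j, c))"
    if "j < length (vs @ [v])" for j
  proof (cases "j = length vs")
    case True
    then have "R ! j = v'" "take j R = R0" "(vs @ [v]) ! j = v"
      using R IH(1) by (simp_all add: nth_append)
    then show ?thesis using v' by (intro exI[of _ c0]) simp
  next
    case False
    then show ?thesis using that IH by (auto simp: R nth_append)
  qed
  ultimately show ?case using IH R by auto
qed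

lemma reduced_cols_dims:
  "length (reduced_cols M) = dim_col M"
  "\<forall>j<dim_col M. dim_vec (reduced_cols M ! j) = dim_row M"
  using matrix_reduction_distinct_pivots(2,3)[of M] by auto

lemma reduced_cols_nth:
  assumes "j < dim_col M"
  obtains c where "reduced_cols M ! j = fst (reduce_column (take j (reduced_cols M)) (col M j, c))"
proof -
  have "set (cols M) \<subseteq> carrier_vec (dim_row M)" by (auto simp: cols_def)
  from reduction_prefix[OF this] that assms show thesis
    unfolding matrix_reduction_eq by (metis cols_length cols_nth prod.collapse)
qed

lemma nnz_reduced_matrix:
  "nnz_mat (reduced_matrix M) = (\<Sum>j<dim_col M. nnz_vec (reduced_cols M ! j))"
proof -
  have "col (reduced_matrix M) j = reduced_cols M ! j" if j: "j < dim_col M" for j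
    unfolding reduced_matrix_def
  proof (rule col_mat_of_cols)
    show "j < length (reduced_cols M)" by (simp only: reduced_cols_dims(1) j)
    show "reduced_cols M ! j \<in> carrier_vec (dim_row M)"
      using reduced_cols_dims(2)[of M] j by (intro carrier_vecI) blast
  qed
  moreover have "dim_col (reduced_matrix M) = dim_col M"
    by (simp only: reduced_matrix_def mat_of_cols_carrier reduced_cols_dims(1))
  ultimately show ?thesis unfolding nnz_mat_def by (intro sum.cong) auto
qed

lemma reduction_cost_le_fill_in: "reduction_cost M \<le> dim_col M * nnz_mat (reduced_matrix M)"
proof -
  have "set (cols M) \<subseteq> carrier_vec (dim_row M)" by (auto simp: cols_def)
  from reduction_prefix[OF this] have "reduction_cost M \<le> dim_col M * (\<Sum>w\<leftarrow>reduced_cols M. nnz_vec w)"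
    unfolding reduction_cost_def matrix_reduction_eq by (metis cols_length prod.collapse)
  then show ?thesis
    by (simp add: nnz_reduced_matrix sum_list_sum_nth reduced_cols_dims atLeast0LessThan)
qed

lemma reduced_cols_closed:
  assumes "J \<le> dim_col M" "\<And>j. j < J \<Longrightarrow> Q (col M j)"
    and add: "\<And>u w. dim_vec u = dim_row M \<Longrightarrow> dim_vec w = dim_row M \<Longrightarrow> Q u \<Longrightarrow> Q w \<Longrightarrow> Q (u + w)"
    and "j < J"
  shows "Q (reduced_cols M ! j)"
  using \<open>j < J\<close>
proof (induction j rule: less_induct)
  case (less j)
  let ?R = "take j (reduced_cols M)"
  obtain c where c: "reduced_cols M ! j = fst (reduce_column ?R (col M j, c))"
    using reduced_cols_nth[of j M] less.prems assms(1) by auto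
  show ?case unfolding c
  proof (rule reduce_column_closed[where m = "dim_row M"])
    show "\<forall>w\<in>set ?R. dim_vec w = dim_row M \<and> Q w"
      using less assms(1) reduced_cols_dims[of M] by (auto simp: in_set_conv_nth)
  qed (use assms less.prems add in auto)
qed

lemma reduced_cols_pivots_inj:
  "inj_on (\<lambda>j. low (reduced_cols M ! j))
     {j. j < dim_col M \<and> reduced_cols M ! j \<noteq> 0\<^sub>v (dim_row M)}"
proof -
  have ne: "low (reduced_cols M ! i) \<noteq> low (reduced_cols M ! j)"
    if "i < j" "j < dim_col M" "reduced_cols M ! i \<noteq> 0\<^sub>v (dim_row M)"
       "reduced_cols M ! j \<noteq> 0\<^sub>v (dim_row M)" for i j
  proof -
    have "dim_vec (reduced_cols M ! i) = dim_row M" "dim_vec (reduced_cols M ! j) = dim_row M"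
      using that(1,2) reduced_cols_dims(2)[of M] by auto
    moreover have "j < length (reduced_cols M)" using that(2) reduced_cols_dims(1)[of M] by simp
    ultimately show ?thesis
      using matrix_reduction_distinct_pivots(1)[of M] that(1,3,4)
      unfolding sorted_wrt_iff_nth_less by force
  qed
  show ?thesis by (rule linorder_inj_onI) (use ne in auto)
qed

text \<open>If no earlier column has an entry in the pivot row, then by closure under addition no
  earlier reduced column has one either, so nothing can be added.\<close>

lemma reduced_col_unchanged:
  assumes "j < dim_col M" "col M j \<noteq> 0\<^sub>v (dim_row M)"
    and first: "\<And>i. i < j \<Longrightarrow> M $$ (low (col M j), i) = 0"
  shows "reduced_cols M ! j = col M j"
proof -
  let ?R = "take j (reduced_cols M)" and ?l = "low (col M j)"
  have l: "?l < dim_row M" using low_props(1)[of "col M j"] assms by simp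
  have z: "vec_index (reduced_cols M ! i) ?l = 0" if "i < j" for i
    by (rule reduced_cols_closed[where J = j and Q = "\<lambda>v. vec_index v ?l = 0"])
      (use assms l that in auto)
  have "find_reducer ?R (col M j) = None"
    unfolding find_reducer_None_iff
  proof (rule disjI2, rule ballI)
    fix w assume "w \<in> set ?R"
    then have "vec_index w ?l = 0" using z assms(1) reduced_cols_dims[of M]
      by (auto simp: in_set_conv_nth)
    then show "w = 0\<^sub>v (dim_vec w) \<or> low w \<noteq> ?l" using low_props(2)[of w] by metis
  qed
  moreover obtain c where "reduced_cols M ! j = fst (reduce_column ?R (col M j, c))"
    using reduced_cols_nth[OF assms(1)] .
  ultimately show ?thesis by (subst (asm) reduce_column_unfold) simp
qed

section \<open>Entrance times and smallest enclosing balls\<close>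

lemma entrance_time_mono:
  fixes X :: "nat \<Rightarrow> 'a::heine_borel"
  assumes "\<sigma> \<subseteq> \<tau>" "finite \<tau>" "\<sigma> \<noteq> {}"
  shows "entrance_time X \<sigma> \<le> entrance_time X \<tau>"
proof (rule cech_cover_closed(2))
  show "finite \<sigma>" "\<sigma> \<noteq> {}" using assms finite_subset by auto
  have "\<tau> \<noteq> {}" using assms by auto
  from cech_cover_closed(1)[OF \<open>finite \<tau>\<close> this, of X]
  show "(\<Inter>p\<in>\<sigma>. cball (X p) (entrance_time X \<tau>)) \<noteq> {}" using assms(1) by blast
qed

text \<open>The centre of a smallest enclosing ball; for points in Euclidean space it is unique
  (\<open>centre_unique\<close>), since the midpoint of two centres would allow a smaller radius.\<close>

lemma ex_centre:
  fixes X :: "nat \<Rightarrow> 'a::heine_borel"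
  assumes "finite \<sigma>" "\<sigma> \<noteq> {}"
  obtains c where "\<forall>p\<in>\<sigma>. dist (X p) c \<le> entrance_time X \<sigma>"
  using cech_cover_closed(1)[OF assms, of X] unfolding cech_cover_iff by blast

lemma entrance_time_le:
  fixes X :: "nat \<Rightarrow> 'a::heine_borel"
  assumes "finite \<sigma>" "\<sigma> \<noteq> {}" "\<forall>p\<in>\<sigma>. dist (X p) c \<le> a"
  shows "entrance_time X \<sigma> \<le> a"
  using cech_cover_closed(2)[OF assms(1,2), of X a] assms(3) unfolding cech_cover_iff by blast

lemma entrance_time_less:
  fixes X :: "nat \<Rightarrow> real ^ 'd"
  assumes "finite \<sigma>" "\<sigma> \<noteq> {}"
  shows "entrance_time X \<sigma> < a \<longleftrightarrow> (\<exists>c. \<forall>p\<in>\<sigma>. dist (X p) c < a)"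
  using entrance_time_less_iff[OF assms, of UNIV X a] by simp

lemma centre_unique:
  fixes X :: "nat \<Rightarrow> real ^ 'd"
  assumes "finite \<sigma>" "\<sigma> \<noteq> {}"
    and "\<forall>p\<in>\<sigma>. dist (X p) c \<le> entrance_time X \<sigma>" "\<forall>p\<in>\<sigma>. dist (X p) c' \<le> entrance_time X \<sigma>"
  shows "c = c'"
proof (rule ccontr)
  assume "c \<noteq> c'"
  then have m: "midpoint c c' \<in> open_segment c c'" by simp
  have "dist (X p) (midpoint c c') < entrance_time X \<sigma>" if "p \<in> \<sigma>" for p
    using dist_decreases_open_segment[OF m, of "X p"] assms(3,4) that by force
  then have "entrance_time X \<sigma> < entrance_time X \<sigma>"
    using entrance_time_less[OF assms(1,2), of X "entrance_time X \<sigma>"] by blast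
  then show False by simp
qed

text \<open>All three simplices have the enclosing ball of \<open>\<omega>\<close>, as centres are unique.\<close>

lemma entrance_time_insert_both:
  fixes X :: "nat \<Rightarrow> real ^ 'd"
  assumes "finite \<omega>" "\<omega> \<noteq> {}"
    and "entrance_time X (insert u \<omega>) = entrance_time X \<omega>"
    and "entrance_time X (insert w \<omega>) = entrance_time X \<omega>"
  shows "entrance_time X (insert u (insert w \<omega>)) = entrance_time X \<omega>"
proof -
  obtain c where c: "\<forall>p\<in>insert u \<omega>. dist (X p) c \<le> entrance_time X \<omega>"
    using ex_centre[of "insert u \<omega>" X] assms by auto
  obtain c' where c': "\<forall>p\<in>insert w \<omega>. dist (X p) c' \<le> entrance_time X \<omega>"
    using ex_centre[of "insert w \<omega>" X] assms by auto
  have "c = c'" using centre_unique[OF assms(1,2)] c c' by auto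
  then have "entrance_time X (insert u (insert w \<omega>)) \<le> entrance_time X \<omega>"
    using c c' assms by (intro entrance_time_le[of _ X c]) auto
  moreover have "entrance_time X \<omega> \<le> entrance_time X (insert u (insert w \<omega>))"
    using assms by (intro entrance_time_mono) auto
  ultimately show ?thesis by simp
qed

text \<open>If either of \<open>u\<close> and \<open>w\<close> can be dropped from \<open>\<omega> \<union> {u, w}\<close> without changing the enclosing ball,
  then so can both. This fails, for example, for two antipodal pairs of points on one circle with
  \<open>u\<close> and \<open>w\<close> taken from different pairs.\<close>

definition generic_points :: "nat \<Rightarrow> (nat \<Rightarrow> 'a::metric_space) \<Rightarrow> bool" where
  "generic_points n X \<longleftrightarrow>
    (\<forall>\<omega>\<in>Pow {..<n} - {{}}. \<forall>u\<in>{..<n} - \<omega>. \<forall>w\<in>{..<n} - insert u \<omega>.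
      entrance_time X (insert u \<omega>) = entrance_time X (insert w (insert u \<omega>)) \<longrightarrow>
      entrance_time X (insert w \<omega>) = entrance_time X (insert w (insert u \<omega>)) \<longrightarrow>
      entrance_time X \<omega> = entrance_time X (insert w (insert u \<omega>)))"

lemma generic_pointsD:
  assumes "generic_points n X" "\<omega> \<subseteq> {..<n}" "\<omega> \<noteq> {}" "u < n" "w < n" "u \<notin> \<omega>" "w \<notin> \<omega>" "u \<noteq> w"
    and "entrance_time X (insert u \<omega>) = entrance_time X (insert w (insert u \<omega>))"
    and "entrance_time X (insert w \<omega>) = entrance_time X (insert w (insert u \<omega>))"
  shows "entrance_time X \<omega> = entrance_time X (insert w (insert u \<omega>))"
  using assms unfolding generic_points_def by fastforce

text \<open>Move the centre \<open>c\<close> slightly towards the centre of a smaller ball around \<open>\<omega>\<close>: the distances to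
  \<open>\<omega>\<close> drop below \<open>r\<close> by convexity, and the distance to \<open>X w\<close> stays below \<open>r\<close> by continuity.\<close>

lemma entrance_time_remove_interior:
  fixes X :: "nat \<Rightarrow> real ^ 'd"
  assumes "finite \<omega>" "\<omega> \<noteq> {}" "\<forall>p\<in>\<omega>. dist (X p) c \<le> r" "dist (X w) c < r"
    and "entrance_time X \<omega> < r"
  shows "entrance_time X (insert w \<omega>) < r"
proof -
  obtain c' where c': "\<forall>p\<in>\<omega>. dist (X p) c' < r"
    using assms(5) entrance_time_less[OF assms(1,2)] by blast
  define m where "m t = c + t *\<^sub>R (c' - c)" for t :: real
  have "((\<lambda>t. dist (X w) (m t)) \<longlongrightarrow> dist (X w) (m 0)) (at_right 0)"
    unfolding m_def by (intro tendsto_intros)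
  then have "\<forall>\<^sub>F t in at_right 0. dist (X w) (m t) < r"
    using assms(4) by (intro order_tendstoD(2)) (auto simp: m_def)
  moreover have "\<forall>\<^sub>F t in at_right (0::real). t < 1" by (rule order_tendstoD(2)[OF tendsto_ident_at]) simp
  moreover have "\<forall>\<^sub>F t in at_right (0::real). t > 0" by (simp add: eventually_at_right_less)
  ultimately have "\<forall>\<^sub>F t in at_right 0. dist (X w) (m t) < r \<and> t < 1 \<and> t > 0" by eventually_elim auto
  then obtain t where t: "dist (X w) (m t) < r" "t < 1" "t > 0"
    using eventually_happens[of _ "at_right (0::real)"] by force
  have "dist (X p) (m t) < r" if "p \<in> \<omega>" for p
  proof -
    have "X p - m t = (1 - t) *\<^sub>R (X p - c) + t *\<^sub>R (X p - c')" by (simp add: m_def algebra_simps)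
    then have "dist (X p) (m t) \<le> (1 - t) * dist (X p) c + t * dist (X p) c'"
      using t by (simp add: dist_norm norm_triangle_le)
    also have "\<dots> < (1 - t) * r + t * r"
      using t assms(3) c' that by (intro add_le_less_mono mult_left_mono mult_strict_left_mono) auto
    finally show ?thesis by (simp add: algebra_simps)
  qed
  with t show ?thesis using entrance_time_less[of "insert w \<omega>" X r] assms(1) by blast
qed

text \<open>The sphere does not depend on \<open>X w\<close>. Hence a violation of genericity confines \<open>X w\<close> to a null set
  once all the other points are fixed.\<close>

lemma non_generic_on_sphere:
  fixes X :: "nat \<Rightarrow> real ^ 'd"
  assumes "finite \<omega>" "\<omega> \<noteq> {}"
    and "entrance_time X (insert u \<omega>) = entrance_time X (insert w (insert u \<omega>))"
    and "entrance_time X (insert w \<omega>) = entrance_time X (insert w (insert u \<omega>))"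
    and "entrance_time X \<omega> \<noteq> entrance_time X (insert w (insert u \<omega>))"
    and c: "\<forall>p\<in>insert u \<omega>. dist (X p) c \<le> entrance_time X (insert u \<omega>)"
  shows "dist (X w) c = entrance_time X (insert u \<omega>)"
proof -
  let ?r = "entrance_time X (insert u \<omega>)"
  obtain c' where c': "\<forall>p\<in>insert w (insert u \<omega>). dist (X p) c' \<le> ?r"
    using ex_centre[of "insert w (insert u \<omega>)" X] assms by auto
  have "c = c'" using centre_unique[of "insert u \<omega>" X c c'] assms(1) c c' by auto
  have "entrance_time X \<omega> \<le> ?r" using assms(1,2) by (intro entrance_time_mono) auto
  then have "\<not> dist (X w) c < ?r"
    using entrance_time_remove_interior[of \<omega> X c ?r w] assms c by force
  with c' \<open>c = c'\<close> show ?thesis by force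
qed

section \<open>Columns with many entries have empty pivots\<close>

lemma sorted_wrt_nth_iff:
  assumes "sorted_wrt P xs" "\<And>x. \<not> P x x" "\<And>x y z. P x y \<Longrightarrow> P y z \<Longrightarrow> P x z"
    and "i < length xs" "j < length xs"
  shows "P (xs ! i) (xs ! j) \<longleftrightarrow> i < j"
  using assms unfolding sorted_wrt_iff_nth_less by (metis linorder_neqE_nat)

lemma insort_lexord:
  fixes a b :: "'a::linorder"
  assumes "a < b" "sorted xs"
  shows "(insort a xs, insort b xs) \<in> lexord {(i, j). i < j}"
  using assms
proof (induction xs)
  case (Cons x xs)
  then show ?case by (cases "a \<le> x"; cases "b \<le> x") (auto simp: less_le insort_is_Cons)
qed simp

lemma lexord_insert:
  fixes a b :: "'a::linorder"
  assumes "a < b" "finite \<omega>" "a \<notin> \<omega>" "b \<notin> \<omega>"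
  shows "(sorted_list_of_set (insert a \<omega>), sorted_list_of_set (insert b \<omega>)) \<in> lexord {(i, j). i < j}"
  using insort_lexord[OF assms(1), of "sorted_list_of_set \<omega>"] assms
  by (simp add: sorted_list_of_set_insert_remove)

text \<open>Among simplices with the same entrance time that differ in one vertex, the lexicographic order
  is the order of that vertex.\<close>

lemma rho_lex_less_insert:
  assumes "a < b" "finite \<omega>" "a \<notin> \<omega>" "b \<notin> \<omega>"
    and "entrance_time X (insert a \<omega>) = entrance_time X (insert b \<omega>)"
  shows "rho_lex_less X (insert a \<omega>) (insert b \<omega>)"
  using lexord_insert[OF assms(1-4)] assms by (simp add: rho_lex_less_def)

lemma rho_lex_less_asym: "rho_lex_less X \<sigma> \<tau> \<Longrightarrow> \<not> rho_lex_less X \<tau> \<sigma>"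
  using rho_lex_less_trans rho_lex_less_irrefl by metis

lemma facetE:
  assumes "facet \<sigma> \<tau>" "finite \<tau>"
  obtains v where "v \<notin> \<sigma>" "\<tau> = insert v \<sigma>"
proof -
  have "finite \<sigma>" "\<sigma> \<subseteq> \<tau>" using assms by (auto simp: facet_def intro: finite_subset)
  then have "card (\<tau> - \<sigma>) = 1" using assms by (simp add: facet_def card_Diff_subset)
  then obtain v where "\<tau> - \<sigma> = {v}" by (auto simp: card_1_singleton_iff)
  with assms(1) have "v \<notin> \<sigma>" "\<tau> = insert v \<sigma>" by (auto simp: facet_def)
  then show thesis by (rule that)
qed

lemma facet_insert: "finite \<sigma> \<Longrightarrow> v \<notin> \<sigma> \<Longrightarrow> facet \<sigma> (insert v \<sigma>)"
  by (auto simp: facet_def)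

text \<open>The reason why the boundary of a boundary vanishes over the field with two elements.\<close>

lemma facets_between:
  assumes "finite \<tau>" "\<omega> \<subseteq> \<tau>" "card \<tau> = card \<omega> + 2"
  shows "card {\<sigma>. facet \<omega> \<sigma> \<and> facet \<sigma> \<tau>} = 2"
proof -
  have fin: "finite \<omega>" using assms(1,2) finite_subset by blast
  have "card (\<tau> - \<omega>) = 2" using assms fin by (simp add: card_Diff_subset)
  then obtain a b where ab: "\<tau> - \<omega> = {a, b}" "a \<noteq> b" by (auto simp: card_2_iff)
  have "{\<sigma>. facet \<omega> \<sigma> \<and> facet \<sigma> \<tau>} = {insert a \<omega>, insert b \<omega>}"
  proof (intro equalityI subsetI)
    fix \<sigma> assume \<sigma>: "\<sigma> \<in> {\<sigma>. facet \<omega> \<sigma> \<and> facet \<sigma> \<tau>}"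
    then have "finite \<sigma>" using assms(1) finite_subset by (metis facet_def mem_Collect_eq)
    with \<sigma> obtain v where "v \<notin> \<omega>" "\<sigma> = insert v \<omega>" using facetE[of \<omega> \<sigma>] by auto
    moreover from this have "v \<in> \<tau> - \<omega>" using \<sigma> by (auto simp: facet_def)
    ultimately show "\<sigma> \<in> {insert a \<omega>, insert b \<omega>}" using ab by auto
  next
    fix \<sigma> assume "\<sigma> \<in> {insert a \<omega>, insert b \<omega>}"
    moreover have "a \<in> \<tau>" "b \<in> \<tau>" "a \<notin> \<omega>" "b \<notin> \<omega>" using ab(1) by blast+
    ultimately show "\<sigma> \<in> {\<sigma>. facet \<omega> \<sigma> \<and> facet \<sigma> \<tau>}"
      using assms(2,3) fin unfolding facet_def by (elim insertE emptyE) (simp_all add: subset_insertI)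
  qed
  moreover have "insert a \<omega> \<noteq> insert b \<omega>" using ab by auto
  ultimately show ?thesis by simp
qed

lemma card_facets:
  assumes "finite \<tau>" "card \<tau> = k + 2"
  shows "card {\<sigma>. facet \<sigma> \<tau>} = k + 2"
proof -
  have "{\<sigma>. facet \<sigma> \<tau>} = {\<sigma>. \<sigma> \<subseteq> \<tau> \<and> card \<sigma> = k + 1}" using assms by (auto simp: facet_def)
  then show ?thesis using n_subsets[OF assms(1), of "k + 1"] assms(2)
    by (simp add: binomial_symmetric[of "k + 1" "k + 2"])
qed

text \<open>Stated for an arbitrary semiring: in the field with two elements, simplification would turn
  sums and equations into parity statements.\<close>

lemma sum_one_eq_card:
  "finite A \<Longrightarrow> (\<Sum>i\<in>A. if P i then 1 else 0) = (of_nat (card {i \<in> A. P i}) :: 'b::semiring_1)"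
  by (simp add: sum.inter_filter[symmetric])

locale cech_reduction =
  fixes n k :: nat and X :: "nat \<Rightarrow> real ^ 'd"
begin

definition "faces = rho_lex_list n X k"
definition "cofaces = rho_lex_list n X (k + 1)"
definition "M = cech_boundary_matrix n X k"
abbreviation "\<rho> \<equiv> entrance_time X"
abbreviation "R \<equiv> reduced_cols M"

lemma dims: "dim_row M = length faces" "dim_col M = length cofaces"
  by (simp_all add: M_def faces_def cofaces_def cech_boundary_matrix_def boundary_matrix_def)

lemma set_faces: "set faces = {\<sigma>. \<sigma> \<subseteq> {..<n} \<and> card \<sigma> = k + 1}"
  by (simp add: faces_def rho_lex_list_props cech_simplices_eq)

lemma set_columns: "set cofaces = {\<tau>. \<tau> \<subseteq> {..<n} \<and> card \<tau> = k + 2}"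
  by (simp add: cofaces_def rho_lex_list_props cech_simplices_eq)

lemma row_simplex:
  assumes "i < length faces"
  shows "faces ! i \<subseteq> {..<n}" "card (faces ! i) = k + 1" "finite (faces ! i)"
  using nth_mem[OF assms] finite_subset by (auto simp: set_faces)

lemma column_simplex:
  assumes "j < dim_col M"
  shows "cofaces ! j \<subseteq> {..<n}" "card (cofaces ! j) = k + 2"
    "finite (cofaces ! j)"
  using nth_mem[of j "cofaces"] finite_subset assms
  by (auto simp: set_columns dims)

lemma faces_order:
  "i < length faces \<Longrightarrow> j < length faces \<Longrightarrow> rho_lex_less X (faces ! i) (faces ! j) \<longleftrightarrow> i < j"
  unfolding faces_def
  by (rule sorted_wrt_nth_iff[OF rho_lex_list_props(2) rho_lex_less_irrefl rho_lex_less_trans])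

lemma columns_order:
  "i < dim_col M \<Longrightarrow> j < dim_col M \<Longrightarrow>
   rho_lex_less X (cofaces ! i) (cofaces ! j) \<longleftrightarrow> i < j"
  unfolding dims cofaces_def
  by (rule sorted_wrt_nth_iff[OF rho_lex_list_props(2) rho_lex_less_irrefl rho_lex_less_trans])

lemma M_nth:
  assumes "i < length faces" "j < dim_col M"
  shows "M $$ (i, j) = (if facet (faces ! i) (cofaces ! j) then 1 else 0)"
  using assms by (simp add: M_def faces_def cofaces_def cech_boundary_matrix_def boundary_matrix_def)

lemma nnz_vec_card:
  assumes "inj_on g {i. i < dim_vec v \<and> vec_index v i \<noteq> 0}" "finite S"
    and "\<And>i. i < dim_vec v \<Longrightarrow> vec_index v i \<noteq> 0 \<Longrightarrow> g i \<in> S"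
  shows "nnz_vec v \<le> card S"
  unfolding nnz_vec_def using assms by (intro card_inj_on_le[of g]) auto

lemma distinct_faces: "distinct faces"
  by (simp add: faces_def rho_lex_list_props)

lemma faces_inj: "inj_on ((!) faces) {i. i < length faces \<and> P i}"
  using distinct_faces by (auto simp: inj_on_def nth_eq_iff_index_eq)

lemma nnz_column:
  assumes "j < dim_col M"
  shows "nnz_vec (col M j) \<le> k + 2"
proof -
  note \<tau> = column_simplex[OF assms]
  have "finite {\<sigma>. facet \<sigma> (cofaces ! j)}"
    by (rule finite_subset[of _ "Pow (cofaces ! j)"]) (auto simp: facet_def \<tau>)
  then have "nnz_vec (col M j) \<le> card {\<sigma>. facet \<sigma> (cofaces ! j)}"
    using assms faces_inj
    by (intro nnz_vec_card[of "(!) faces"]) (auto simp: dims M_nth split: if_splits)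
  then show ?thesis using card_facets \<tau> by simp
qed

text \<open>The boundary of the chain in a reduced column has coefficient 0 at every \<open>\<omega>\<close>: this holds for
  the columns of a boundary matrix and is preserved by addition.\<close>

lemma reduced_col_cycle:
  assumes "j < dim_col M" "\<omega> \<subseteq> {..<n}" "card \<omega> = k"
  shows "(\<Sum>i<length faces. if facet \<omega> (faces ! i) then vec_index (R ! j) i else 0) = 0"
proof (rule reduced_cols_closed[where J = "dim_col M"])
  fix j assume j: "j < dim_col M"
  let ?\<tau> = "cofaces ! j"
  note \<tau> = column_simplex[OF j]
  let ?I = "{i. i < length faces \<and> facet \<omega> (faces ! i) \<and> facet (faces ! i) ?\<tau>}"
  have "(\<Sum>i<length faces. if facet \<omega> (faces ! i) then vec_index (col M j) i else 0)
      = (\<Sum>i<length faces. if i \<in> ?I then 1 else 0)"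
    using j by (intro sum.cong) (auto simp: M_nth dims)
  also have "\<dots> = of_nat (card ?I)"
    by (subst sum_one_eq_card) (simp_all only: finite_lessThan lessThan_iff mem_Collect_eq conj_assoc[symmetric] conj_absorb)
  also have "card ?I = card ((!) faces ` ?I)" using faces_inj by (subst card_image) auto
  also have "(!) faces ` ?I = {\<sigma>. facet \<omega> \<sigma> \<and> facet \<sigma> ?\<tau>}"
  proof (intro equalityI subsetI)
    fix \<sigma> assume \<sigma>: "\<sigma> \<in> {\<sigma>. facet \<omega> \<sigma> \<and> facet \<sigma> ?\<tau>}"
    then have "\<sigma> \<in> set faces" using \<tau> by (auto simp: set_faces facet_def)
    then show "\<sigma> \<in> (!) faces ` ?I" using \<sigma> by (auto simp: in_set_conv_nth)
  qed auto
  also have "of_nat (card \<dots>) = (0 :: bit)"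
  proof (cases "\<omega> \<subseteq> ?\<tau>")
    case True
    then show ?thesis using facets_between[of ?\<tau> \<omega>] \<tau> assms(3) by simp
  next
    case False
    then have "{\<sigma>. facet \<omega> \<sigma> \<and> facet \<sigma> ?\<tau>} = {}" by (auto simp: facet_def)
    then show ?thesis by (simp only: card.empty of_nat_0)
  qed
  finally show "(\<Sum>i<length faces. if facet \<omega> (faces ! i) then vec_index (col M j) i else 0) = 0" .
next
  fix u w :: "bit Matrix.vec"
  let ?S = "\<lambda>v. (\<Sum>i<length faces. if facet \<omega> (faces ! i) then vec_index v i else 0)"
  assume "dim_vec u = dim_row M" "dim_vec w = dim_row M" "?S u = 0" "?S w = 0"
  moreover from this have "?S (u + w) = ?S u + ?S w"
    unfolding sum.distrib[symmetric] by (intro sum.cong) (auto simp: dims)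
  ultimately show "?S (u + w) = 0" by simp
qed (use assms in auto)

text \<open>If the pivot simplex were the first coface of its facet \<open>\<omega>\<close>, then it would be the only simplex of
  the column that contains \<open>\<omega>\<close>, and the boundary of the column would have the entry 1 at \<open>\<omega>\<close>.\<close>

lemma earlier_coface_below_pivot:
  assumes "j < dim_col M" "R ! j \<noteq> 0\<^sub>v (dim_row M)"
    and "\<omega> \<subseteq> {..<n}" "card \<omega> = k" "facet \<omega> (faces ! low (R ! j))"
  obtains i where "i < low (R ! j)" "facet \<omega> (faces ! i)"
proof (rule ccontr)
  assume "\<not> thesis"
  with that have no: "\<not> facet \<omega> (faces ! i)" if "i < low (R ! j)" for i using that by blast
  let ?l = "low (R ! j)"
  have dim: "dim_vec (R ! j) = length faces" using reduced_cols_dims[of M] assms dims by auto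
  have l: "?l < length faces" "vec_index (R ! j) ?l \<noteq> 0"
    "\<And>i. i < length faces \<Longrightarrow> vec_index (R ! j) i \<noteq> 0 \<Longrightarrow> i \<le> ?l"
    using low_props[of "R ! j"] assms(2) dim dims by auto
  have "(\<Sum>i<length faces. if facet \<omega> (faces ! i) then vec_index (R ! j) i else 0)
      = (\<Sum>i<length faces. if i = ?l then vec_index (R ! j) ?l else 0)"
  proof (intro sum.cong refl)
    fix i assume "i \<in> {..<length faces}"
    then show "(if facet \<omega> (faces ! i) then vec_index (R ! j) i else 0)
        = (if i = ?l then vec_index (R ! j) ?l else 0)"
      using no[of i] l(3)[of i] assms(5)
      by (cases i ?l rule: linorder_cases) (auto simp del: bit_not_zero_iff)
  qed
  also have "\<dots> = vec_index (R ! j) ?l" using l(1) by simp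
  finally show False using reduced_col_cycle[OF assms(1,3,4)] l(2) by simp
qed

text \<open>A pivot and its first coface \<open>\<tau>\<close> form an apparent pair if the pivot is the last facet of \<open>\<tau>\<close>. The
  column of \<open>\<tau>\<close> is then left unchanged by the reduction, and as pivots are distinct it is column
  \<open>j\<close> itself.\<close>

lemma apparent_pair:
  assumes "j < dim_col M" "R ! j \<noteq> 0\<^sub>v (dim_row M)"
    and "\<tau> \<subseteq> {..<n}" "facet (faces ! low (R ! j)) \<tau>"
    and first: "\<And>\<tau>'. \<tau>' \<subseteq> {..<n} \<Longrightarrow> facet (faces ! low (R ! j)) \<tau>' \<Longrightarrow> \<not> rho_lex_less X \<tau>' \<tau>"
    and last: "\<And>\<sigma>. facet \<sigma> \<tau> \<Longrightarrow> \<not> rho_lex_less X (faces ! low (R ! j)) \<sigma>"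
  shows "nnz_vec (R ! j) \<le> k + 2"
proof -
  let ?l = "low (R ! j)"
  have l: "?l < length faces" using low_props(1)[of "R ! j"] assms(1,2) reduced_cols_dims[of M] dims
    by auto
  have "\<tau> \<in> set cofaces" using assms(3,4) row_simplex[OF l] by (auto simp: set_columns facet_def)
  then obtain j' where j': "j' < dim_col M" "cofaces ! j' = \<tau>" by (auto simp: in_set_conv_nth dims)
  have nz: "vec_index (col M j') ?l \<noteq> 0" using j' l assms(4) by (simp add: M_nth dims)
  then have ne: "col M j' \<noteq> 0\<^sub>v (dim_row M)" using l dims by auto
  let ?l' = "low (col M j')"
  have l': "?l' < length faces" "vec_index (col M j') ?l' \<noteq> 0" "?l \<le> ?l'"
    using low_props[of "col M j'"] ne nz l dims by auto
  then have "facet (faces ! ?l') \<tau>" using j' by (simp add: M_nth dims split: if_splits)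
  then have "\<not> ?l < ?l'" using last faces_order l l'(1) by blast
  with l' have low: "?l' = ?l" by simp
  have "M $$ (?l', i) = 0" if "i < j'" for i
    using first[of "cofaces ! i"] columns_order[of i j'] column_simplex[of i] that j' l
    by (auto simp: M_nth low)
  then have eq: "R ! j' = col M j'" using reduced_col_unchanged[OF j'(1) ne] by simp
  have "j' = j"
    using inj_onD[OF reduced_cols_pivots_inj, of M j' j] eq low ne j' assms by auto
  then show ?thesis using eq nnz_column j' by simp
qed

text \<open>The smallest vertex \<open>w\<close> in the enclosing ball outside \<open>\<sigma>\<close> gives the first coface of \<open>\<sigma>\<close>. If \<open>\<sigma>\<close>
  is not its last facet, then some \<open>x \<in> \<sigma>\<close> with \<open>x < w\<close> can be dropped from \<open>\<sigma> \<union> {w}\<close>, and by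
  genericity also from \<open>\<sigma>\<close>, without changing the enclosing ball. This makes \<open>\<sigma>\<close> the first coface of
  \<open>\<sigma> - {x}\<close>. The assumption \<open>k \<ge> 1\<close> makes \<open>\<sigma> - {x}\<close> non-empty.\<close>

lemma pivot_dichotomy:
  assumes "k \<ge> 1" and generic: "generic_points n X"
    and j: "j < dim_col M" "R ! j \<noteq> 0\<^sub>v (dim_row M)"
    and full: "nnz_vec (R ! j) > k + 2"
    and v: "v < n" "v \<notin> faces ! low (R ! j)"
  shows "\<rho> (faces ! low (R ! j)) < \<rho> (insert v (faces ! low (R ! j)))"
proof (rule ccontr)
  let ?\<sigma> = "faces ! low (R ! j)"
  have l: "low (R ! j) < length faces"
    using low_props(1)[of "R ! j"] j reduced_cols_dims[of M] dims by auto
  note \<sigma> = row_simplex[OF l]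
  have ne: "?\<sigma> \<noteq> {}" using \<sigma>(2) by auto
  have mono: "\<rho> ?\<sigma> \<le> \<rho> (insert u ?\<sigma>)" for u using \<sigma> ne by (intro entrance_time_mono) auto
  define P where "P u \<longleftrightarrow> u < n \<and> u \<notin> ?\<sigma> \<and> \<rho> (insert u ?\<sigma>) = \<rho> ?\<sigma>" for u
  assume "\<not> ?thesis"
  then have "P v" using v mono[of v] by (simp add: P_def)
  define w where "w = (LEAST u. P u)"
  have Pw: "P w" unfolding w_def by (rule LeastI, rule \<open>P v\<close>)
  then have w: "w < n" "w \<notin> ?\<sigma>" "\<rho> (insert w ?\<sigma>) = \<rho> ?\<sigma>" by (auto simp: P_def)
  have least: "w \<le> u" if "P u" for u unfolding w_def using that by (rule Least_le)
  \<comment> \<open>Otherwise \<open>?\<sigma>\<close> and \<open>insert w ?\<sigma>\<close> form an apparent pair.\<close>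
  have "\<exists>\<sigma>. facet \<sigma> (insert w ?\<sigma>) \<and> rho_lex_less X ?\<sigma> \<sigma>"
  proof (rule ccontr)
    assume last: "\<nexists>\<sigma>. facet \<sigma> (insert w ?\<sigma>) \<and> rho_lex_less X ?\<sigma> \<sigma>"
    have first: "\<not> rho_lex_less X \<tau>' (insert w ?\<sigma>)" if \<tau>': "\<tau>' \<subseteq> {..<n}" "facet ?\<sigma> \<tau>'" for \<tau>'
    proof -
      have "finite \<tau>'" using \<tau>' finite_subset by auto
      then obtain u where u: "u \<notin> ?\<sigma>" "\<tau>' = insert u ?\<sigma>" using facetE \<tau>'(2) by metis
      show ?thesis
      proof (cases "\<rho> \<tau>' = \<rho> ?\<sigma>")
        case True
        then have "w \<le> u" using least[of u] u \<tau>' by (auto simp: P_def)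
        then show ?thesis
          using rho_lex_less_irrefl[of X] rho_lex_less_insert[of w u ?\<sigma> X] u w True \<sigma>(3)
            rho_lex_less_asym[of X] by (cases "w = u") auto
      next
        case False
        then have "\<rho> (insert w ?\<sigma>) < \<rho> \<tau>'" using mono[of u] u w by simp
        then show ?thesis using rho_lex_less_asym by (auto simp: rho_lex_less_def)
      qed
    qed
    have "nnz_vec (R ! j) \<le> k + 2"
    proof (rule apparent_pair[OF j])
      show "insert w ?\<sigma> \<subseteq> {..<n}" "facet ?\<sigma> (insert w ?\<sigma>)" using w \<sigma> facet_insert by auto
    qed (use first last in auto)
    with full show False by simp
  qed
  then obtain \<sigma>' where \<sigma>': "facet \<sigma>' (insert w ?\<sigma>)" "rho_lex_less X ?\<sigma> \<sigma>'" by blast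
  have fin\<sigma>': "finite \<sigma>'" using \<sigma>' \<sigma> finite_subset[of \<sigma>' "insert w ?\<sigma>"] by (auto simp: facet_def)
  obtain x where x: "x \<notin> \<sigma>'" "insert w ?\<sigma> = insert x \<sigma>'" using facetE[OF \<sigma>'(1)] \<sigma> by auto
  define \<omega> where "\<omega> = ?\<sigma> - {x}"
  have "x \<noteq> w"
  proof
    assume "x = w"
    then have "\<sigma>' = ?\<sigma>" using x w(2) by (metis insert_ident)
    then show False using \<sigma>'(2) rho_lex_less_irrefl by metis
  qed
  moreover have "x \<in> insert w ?\<sigma>" "w \<in> insert x \<sigma>'"
    using x(2) by (simp, metis insertI1)
  ultimately have x\<sigma>: "x \<in> ?\<sigma>" "w \<in> \<sigma>'" by simp_all
  then have \<omega>: "?\<sigma> = insert x \<omega>" "\<sigma>' = insert w \<omega>" "x \<notin> \<omega>" "w \<notin> \<omega>"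
    using x w by (auto simp: \<omega>_def)
  have fin\<omega>: "finite \<omega>" "\<omega> \<subseteq> {..<n}" "card \<omega> = k" using \<sigma> x\<sigma> by (auto simp: \<omega>_def)
  have ne\<omega>: "\<omega> \<noteq> {}" using fin\<omega>(3) assms(1) by auto
  have "\<rho> \<sigma>' \<le> \<rho> (insert x \<sigma>')" using fin\<sigma>' \<omega>(2) by (intro entrance_time_mono) auto
  then have "\<rho> \<sigma>' \<le> \<rho> ?\<sigma>" using x(2) w(3) by simp
  moreover have "\<rho> ?\<sigma> \<le> \<rho> \<sigma>'" using \<sigma>'(2) by (auto simp: rho_lex_less_def)
  ultimately have eq: "\<rho> \<sigma>' = \<rho> ?\<sigma>" by simp
  \<comment> \<open>\<open>\<sigma>'\<close> and \<open>?\<sigma>\<close> enter together, so their order is that of the exchanged vertices.\<close>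
  have "x < w"
  proof (rule ccontr)
    assume "\<not> x < w"
    then have "w < x" using \<open>x \<noteq> w\<close> by simp
    then have "rho_lex_less X \<sigma>' ?\<sigma>"
      using rho_lex_less_insert[of w x \<omega> X] \<omega> fin\<omega> eq by simp
    then show False using \<sigma>'(2) rho_lex_less_asym by blast
  qed
  have "\<rho> \<omega> = \<rho> (insert w (insert x \<omega>))"
  proof (rule generic_pointsD[OF generic fin\<omega>(2) ne\<omega>])
    show "\<rho> (insert x \<omega>) = \<rho> (insert w (insert x \<omega>))" using w(3) \<omega>(1) by simp
    show "\<rho> (insert w \<omega>) = \<rho> (insert w (insert x \<omega>))" using eq w(3) \<omega>(1,2) by simp
  qed (use \<sigma>(1) x\<sigma>(1) w(1) \<omega>(3,4) \<open>x < w\<close> in auto)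
  then have r\<omega>: "\<rho> \<omega> = \<rho> ?\<sigma>" using w(3) \<omega>(1) by simp
  \<comment> \<open>Now \<open>?\<sigma>\<close> is the first coface of \<open>\<omega>\<close>: an earlier one would add a vertex \<open>u\<close> that lies in the
    same enclosing ball, outside \<open>?\<sigma>\<close> and hence not below \<open>w > x\<close>.\<close>
  obtain i where i: "i < low (R ! j)" "facet \<omega> (faces ! i)"
    using earlier_coface_below_pivot[OF j fin\<omega>(2,3)] facet_insert[of \<omega> x] fin\<omega> \<omega> by auto
  have il: "i < length faces" using i l by simp
  then obtain u where u: "u \<notin> \<omega>" "faces ! i = insert u \<omega>" using facetE[OF i(2)] row_simplex by metis
  have less: "rho_lex_less X (faces ! i) ?\<sigma>" using faces_order[OF il l] i by simp
  have un: "u < n" using u row_simplex(1)[OF il] by auto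
  have "\<rho> \<omega> \<le> \<rho> (insert u \<omega>)" using fin\<omega> ne\<omega> by (intro entrance_time_mono) auto
  moreover have "\<rho> (insert u \<omega>) \<le> \<rho> ?\<sigma>" using less u by (auto simp: rho_lex_less_def)
  ultimately have ru: "\<rho> (insert u \<omega>) = \<rho> \<omega>" using r\<omega> by simp
  have "u \<noteq> x" using less u \<omega>(1) rho_lex_less_irrefl by metis
  have rx: "\<rho> (insert x \<omega>) = \<rho> \<omega>" by (simp only: \<omega>(1)[symmetric] r\<omega>)
  have "\<rho> (insert u ?\<sigma>) = \<rho> \<omega>"
    unfolding \<omega>(1) by (rule entrance_time_insert_both[OF fin\<omega>(1) ne\<omega> ru rx])
  moreover have "u \<notin> ?\<sigma>" using u(1) \<open>u \<noteq> x\<close> \<omega>(1) by blast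
  ultimately have "P u" using un r\<omega> unfolding P_def by simp
  then have "x < u" using least \<open>x < w\<close> by force
  then have "rho_lex_less X (insert x \<omega>) (insert u \<omega>)"
    using rho_lex_less_insert[of x u \<omega> X] \<omega>(3) u(1) fin\<omega>(1) ru rx by simp
  then have "rho_lex_less X ?\<sigma> (faces ! i)" by (simp only: u(2) \<omega>(1)[symmetric])
  then show False using less rho_lex_less_asym by blast
qed

lemma card_nonzero_reduced_cols:
  assumes "finite S" "\<And>j. j < dim_col M \<Longrightarrow> R ! j \<noteq> 0\<^sub>v (dim_row M) \<Longrightarrow> P j \<Longrightarrow> faces ! low (R ! j) \<in> S"
  shows "card {j. j < dim_col M \<and> R ! j \<noteq> 0\<^sub>v (dim_row M) \<and> P j} \<le> card S"
proof (rule card_inj_on_le[of "\<lambda>j. faces ! low (R ! j)"])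
  let ?J = "{j. j < dim_col M \<and> R ! j \<noteq> 0\<^sub>v (dim_row M)}"
  have "low (R ! j) < length faces" if "j \<in> ?J" for j
    using low_props(1)[of "R ! j"] that reduced_cols_dims(2)[of M] dims(1) by auto
  then have "inj_on ((!) faces) ((\<lambda>j. low (R ! j)) ` ?J)"
    using distinct_faces by (auto simp: inj_on_def nth_eq_iff_index_eq)
  then have "inj_on ((!) faces \<circ> (\<lambda>j. low (R ! j))) ?J"
    using reduced_cols_pivots_inj comp_inj_on by blast
  then show "inj_on (\<lambda>j. faces ! low (R ! j)) {j. j < dim_col M \<and> R ! j \<noteq> 0\<^sub>v (dim_row M) \<and> P j}"
    unfolding comp_def by (rule inj_on_subset) auto
qed (use assms in auto)

lemma nnz_zero_col: "nnz_vec (0\<^sub>v m) = 0"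
  by (simp add: nnz_vec_def)

lemma nnz_le_entrance_time:
  assumes "j < dim_col M" "R ! j \<noteq> 0\<^sub>v (dim_row M)" "\<rho> (faces ! low (R ! j)) \<le> r"
  shows "nnz_vec (R ! j) \<le> card {\<sigma> \<in> set faces. \<rho> \<sigma> \<le> r}"
proof (rule nnz_vec_card[of "(!) faces"])
  have dim: "dim_vec (R ! j) = length faces" using reduced_cols_dims(2)[of M] assms(1) dims by simp
  show "inj_on ((!) faces) {i. i < dim_vec (R ! j) \<and> vec_index (R ! j) i \<noteq> 0}"
    unfolding dim by (rule faces_inj)
  note low = low_props[of "R ! j", unfolded dim]
  fix i assume i: "i < dim_vec (R ! j)" "vec_index (R ! j) i \<noteq> 0"
  have ne: "R ! j \<noteq> 0\<^sub>v (length faces)" using assms(2) dims by simp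
  have "i \<le> low (R ! j)" using low(3)[OF ne] i dim by simp
  then have "i = low (R ! j) \<or> rho_lex_less X (faces ! i) (faces ! low (R ! j))"
    using faces_order[of i "low (R ! j)"] low(1)[OF ne] i dim by auto
  then have "\<rho> (faces ! i) \<le> \<rho> (faces ! low (R ! j))" by (auto simp: rho_lex_less_def)
  then show "faces ! i \<in> {\<sigma> \<in> set faces. \<rho> \<sigma> \<le> r}" using i dim assms(3) by simp
qed simp

lemma fill_in_trivial: "nnz_mat (reduced_matrix M) \<le> card (set faces) * card (set faces)"
proof -
  let ?J = "{j. j < dim_col M \<and> R ! j \<noteq> 0\<^sub>v (dim_row M) \<and> True}"
  have "nnz_mat (reduced_matrix M) = (\<Sum>j\<in>?J. nnz_vec (R ! j))"
    unfolding nnz_reduced_matrix by (rule sum.mono_neutral_right) (auto simp: nnz_zero_col)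
  also have "\<dots> \<le> of_nat (card ?J) * card (set faces)"
  proof (rule sum_bounded_above)
    fix j assume "j \<in> ?J"
    then have "dim_vec (R ! j) = length faces" using reduced_cols_dims(2)[of M] dims by simp
    then show "nnz_vec (R ! j) \<le> card (set faces)"
      using faces_inj by (intro nnz_vec_card[of "(!) faces"]) auto
  qed
  also have "\<dots> \<le> card (set faces) * card (set faces)"
  proof -
    have "card ?J \<le> card (set faces)"
    proof (rule card_nonzero_reduced_cols)
      fix j assume "j < dim_col M" "R ! j \<noteq> 0\<^sub>v (dim_row M)"
      then have "low (R ! j) < length faces"
        using low_props(1)[of "R ! j"] reduced_cols_dims(2)[of M] dims(1) by auto
      then show "faces ! low (R ! j) \<in> set faces" by simp
    qed simp
    then show ?thesis by (simp add: mult_le_mono1)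
  qed
  finally show ?thesis .
qed

text \<open>The columns with at most \<open>k + 2\<close> entries are no more than the rows, as pivots are distinct. Each
  of the other columns has an empty pivot; both the number of these pivots and the number
  of entries above one of them are bounded by the number of simplices that have entered by time
  \<open>r\<close>.\<close>

lemma fill_in_bound:
  assumes "k \<ge> 1" "generic_points n X"
    and r: "\<And>\<sigma>. \<sigma> \<in> set faces \<Longrightarrow> \<forall>v<n. v \<notin> \<sigma> \<longrightarrow> \<rho> \<sigma> < \<rho> (insert v \<sigma>) \<Longrightarrow> \<rho> \<sigma> \<le> r"
  shows "nnz_mat (reduced_matrix M)
    \<le> (k + 2) * card (set faces) + (card {\<sigma> \<in> set faces. \<rho> \<sigma> \<le> r})\<^sup>2"
proof -
  let ?N = "card {\<sigma> \<in> set faces. \<rho> \<sigma> \<le> r}"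
  let ?J = "\<lambda>P. {j. j < dim_col M \<and> R ! j \<noteq> 0\<^sub>v (dim_row M) \<and> P j}"
  define P where "P j \<longleftrightarrow> nnz_vec (R ! j) \<le> k + 2" for j
  have low: "low (R ! j) < length faces" if "j < dim_col M" "R ! j \<noteq> 0\<^sub>v (dim_row M)" for j
    using that low_props(1)[of "R ! j"] reduced_cols_dims(2)[of M] dims(1) by auto
  have late: "\<rho> (faces ! low (R ! j)) \<le> r" if "j \<in> ?J (\<lambda>j. \<not> P j)" for j
    using that low[of j] pivot_dichotomy[OF assms(1,2), of j]
    by (intro r) (auto simp: P_def)
  have "nnz_mat (reduced_matrix M) = (\<Sum>j\<in>?J P \<union> ?J (\<lambda>j. \<not> P j). nnz_vec (R ! j))"
    unfolding nnz_reduced_matrix by (rule sum.mono_neutral_right) (auto simp: nnz_zero_col)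
  then have split: "nnz_mat (reduced_matrix M) =
      (\<Sum>j\<in>?J P. nnz_vec (R ! j)) + (\<Sum>j\<in>?J (\<lambda>j. \<not> P j). nnz_vec (R ! j))"
    by (subst (asm) sum.union_disjoint) auto
  have "(\<Sum>j\<in>?J P. nnz_vec (R ! j)) \<le> of_nat (card (?J P)) * (k + 2)"
    by (rule sum_bounded_above) (auto simp: P_def)
  also have "\<dots> \<le> card (set faces) * (k + 2)"
    using low card_nonzero_reduced_cols[of "set faces" P] by (intro mult_le_mono1) simp
  finally have few: "(\<Sum>j\<in>?J P. nnz_vec (R ! j)) \<le> (k + 2) * card (set faces)"
    by (simp only: mult.commute)
  have "(\<Sum>j\<in>?J (\<lambda>j. \<not> P j). nnz_vec (R ! j)) \<le> of_nat (card (?J (\<lambda>j. \<not> P j))) * ?N"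
    using late by (intro sum_bounded_above nnz_le_entrance_time) auto
  also have "\<dots> \<le> ?N * ?N"
    using low late card_nonzero_reduced_cols[of "{\<sigma> \<in> set faces. \<rho> \<sigma> \<le> r}" "\<lambda>j. \<not> P j"]
    by (intro mult_le_mono1) simp
  finally show ?thesis using few split by (simp only: power2_eq_square)
qed

end

section \<open>Independent uniform points are generic\<close>

abbreviation cube_measure :: "(real ^ 'd) measure" where
  "cube_measure \<equiv> uniform_measure lborel unit_cube"

lemma emeasure_unit_cube: "emeasure lborel (unit_cube :: (real ^ 'd) set) = 1"
proof -
  have "(\<chi> i. 0) \<in> (unit_cube :: (real ^ 'd) set)" by (simp add: unit_cube_def mem_box_cart)
  then have "measure lborel (unit_cube :: (real ^ 'd) set) = 1"
    unfolding unit_cube_def by (subst content_cbox_cart) auto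
  moreover have "emeasure lborel (unit_cube :: (real ^ 'd) set) \<noteq> \<infinity>"
    using emeasure_lborel_cbox_finite unfolding unit_cube_def by (metis less_irrefl)
  ultimately show ?thesis by (simp add: emeasure_eq_ennreal_measure)
qed

lemma borel_unit_cube [measurable, simp]: "unit_cube \<in> sets borel"
  by (simp add: unit_cube_def)

lemma measure_cube_measure:
  assumes "A \<in> sets borel"
  shows "measure (cube_measure :: (real ^ 'd) measure) A = measure lborel (unit_cube \<inter> A)"
proof -
  have "measure lborel (unit_cube :: (real ^ 'd) set) = 1"
    using emeasure_unit_cube[where 'd = 'd] by (simp add: measure_def)
  then show ?thesis using assms emeasure_unit_cube[where 'd = 'd] by (subst measure_uniform_measure) auto
qed

lemma space_uniform_points: "space (uniform_points n) = {..<n} \<rightarrow>\<^sub>E UNIV"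
  by (simp add: uniform_points_def space_PiM)

lemma measurable_point:
  assumes "i < n"
  shows "(\<lambda>X. X i) \<in> borel_measurable (uniform_points n :: (nat \<Rightarrow> real ^ 'd) measure)"
proof -
  have "(\<lambda>X. X i) \<in> measurable (uniform_points n) (cube_measure :: (real ^ 'd) measure)"
    unfolding uniform_points_def using assms by (intro measurable_component_singleton) auto
  then show ?thesis by (simp cong: measurable_cong_sets)
qed

lemma sets_all_in:
  assumes "T \<subseteq> {..<n}" "A \<in> sets borel"
  shows "{X \<in> space (uniform_points n). \<forall>i\<in>T. X i \<in> A} \<in> sets (uniform_points n :: (nat \<Rightarrow> real ^ 'd) measure)"
proof (intro sets.sets_Collect_finite_All)
  fix i assume "i \<in> T"
  then have "i < n" using assms(1) by auto
  from measurable_sets[OF measurable_point[OF this] assms(2)]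
  show "{X \<in> space (uniform_points n :: (nat \<Rightarrow> real ^ 'd) measure). X i \<in> A} \<in> sets (uniform_points n)"
    by (simp add: vimage_def Int_def conj_commute)
qed (use assms finite_subset in auto)

text \<open>The only place where independence enters, apart from \<open>AE_generic_points\<close>.\<close>

lemma prob_all_in:
  fixes A :: "(real ^ 'd) set"
  assumes T: "T \<subseteq> {..<n}" and A: "A \<in> sets borel"
  shows "measure (uniform_points n) {X \<in> space (uniform_points n). \<forall>i\<in>T. X i \<in> A}
    = measure cube_measure A ^ card T"
proof -
  let ?U = "cube_measure :: (real ^ 'd) measure"
  interpret U: prob_space ?U by (rule prob_space_uniform_cube)
  interpret product_sigma_finite "\<lambda>_. ?U" by unfold_locales
  let ?E = "\<lambda>i. if i \<in> T then A else UNIV"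
  have E: "emeasure ?U (?E i) = (if i \<in> T then ennreal (measure ?U A) else 1)" for i
    using U.emeasure_space_1 by (simp add: U.emeasure_eq_measure)
  have "{X \<in> space (uniform_points n). \<forall>i\<in>T. X i \<in> A} = PiE {..<n} ?E"
    using T by (auto simp: space_uniform_points PiE_def Pi_iff split: if_splits)
  then have "emeasure (uniform_points n) {X \<in> space (uniform_points n). \<forall>i\<in>T. X i \<in> A}
      = (\<Prod>i<n. emeasure ?U (?E i))"
    unfolding uniform_points_def using A by (simp only:) (subst emeasure_PiM, auto)
  also have "\<dots> = ennreal (measure ?U A) ^ card T"
    using T by (simp only: E) (simp add: prod.If_cases inf.absorb2 Int_absorb1)
  also have "\<dots> = ennreal (measure ?U A ^ card T)" by (simp add: ennreal_power)
  finally show ?thesis by (simp add: measure_def)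
qed

text \<open>The union bound behind both exceptional events.\<close>

lemma prob_ex_all_in:
  fixes A :: "'i \<Rightarrow> (real ^ 'd) set" and n t :: nat
  assumes "finite I" "\<And>a. a \<in> I \<Longrightarrow> A a \<in> sets borel" "\<And>a. a \<in> I \<Longrightarrow> measure cube_measure (A a) \<le> q"
  defines "S \<equiv> {X \<in> space (uniform_points n). \<exists>a\<in>I. \<exists>T. T \<subseteq> {..<n} \<and> card T = t \<and> (\<forall>i\<in>T. X i \<in> A a)}"
  shows "S \<in> sets (uniform_points n)"
    and "measure (uniform_points n) S \<le> real (card I) * real (n choose t) * q ^ t"
proof -
  let ?M = "uniform_points n :: (nat \<Rightarrow> real ^ 'd) measure"
  let ?P = "\<lambda>a T. {X \<in> space ?M. \<forall>i\<in>T. X i \<in> A a}"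
  let ?J = "I \<times> {T. T \<subseteq> {..<n} \<and> card T = t}"
  have fin: "finite ?J" using assms(1) by auto
  have S: "S = (\<Union>(a, T)\<in>?J. ?P a T)" unfolding S_def by auto
  have sets: "?P (fst j) (snd j) \<in> sets ?M" if "j \<in> ?J" for j
    using that assms(2) by (intro sets_all_in) auto
  then show "S \<in> sets ?M" unfolding S using fin by (auto simp: case_prod_beta)
  have "measure ?M S \<le> (\<Sum>j\<in>?J. measure ?M (?P (fst j) (snd j)))"
    unfolding S case_prod_beta using fin sets by (intro measure_UNION_le) auto
  also have "\<dots> \<le> (\<Sum>j\<in>?J. q ^ t)"
  proof (rule sum_mono)
    fix j assume j: "j \<in> ?J"
    then have "measure ?M (?P (fst j) (snd j)) = measure cube_measure (A (fst j)) ^ t"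
      using assms(2) by (subst prob_all_in) auto
    also have "\<dots> \<le> q ^ t" using j assms(3) by (intro power_mono) auto
    finally show "measure ?M (?P (fst j) (snd j)) \<le> q ^ t" .
  qed
  also have "\<dots> = real (card I) * real (n choose t) * q ^ t"
    by (simp add: card_cartesian_product n_subsets)
  finally show "measure ?M S \<le> real (card I) * real (n choose t) * q ^ t" .
qed

lemma AE_in_cube: "AE X in (uniform_points n :: (nat \<Rightarrow> real ^ 'd) measure). \<forall>i<n. X i \<in> unit_cube"
proof -
  let ?M = "uniform_points n :: (nat \<Rightarrow> real ^ 'd) measure"
  interpret prob_space ?M by (rule prob_space_uniform_points)
  have "measure (cube_measure :: (real ^ 'd) measure) unit_cube = 1"
    using emeasure_unit_cube[where 'd = 'd] by (simp add: measure_cube_measure borel_unit_cube measure_def)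
  then have "prob {X \<in> space ?M. \<forall>i\<in>{..<n}. X i \<in> unit_cube} = 1"
    by (subst prob_all_in) (auto simp: borel_unit_cube)
  from AE_prob_1[OF this] show ?thesis by eventually_elim auto
qed

lemma entrance_time_cong:
  assumes "\<And>p. p \<in> \<sigma> \<Longrightarrow> X p = Y p"
  shows "entrance_time X \<sigma> = entrance_time Y \<sigma>"
  unfolding entrance_time_def using assms by (simp cong: INF_cong_simp)

lemma emeasure_cube_measure_sphere: "emeasure cube_measure (sphere (c :: real ^ 'd) r) = 0"
proof -
  have "sphere c r \<in> null_sets lborel"
    using negligible_sphere[of c r]
    by (auto simp: null_sets_completion_iff negligible_iff_null_sets)
  then have "emeasure lborel (unit_cube \<inter> sphere c r) = 0"
    by (intro null_setsD1 null_set_Int1) (auto simp: borel_unit_cube Int_commute)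
  then show ?thesis by (simp add: borel_unit_cube)
qed

text \<open>By Fubini, integrating over the position of \<open>w\<close> first: it would have to lie on a sphere that is
  determined by the other points (\<open>non_generic_on_sphere\<close>).\<close>

lemma AE_generic_points:
  "AE X in (uniform_points n :: (nat \<Rightarrow> real ^ 'd) measure). generic_points n X"
proof -
  let ?M = "uniform_points n :: (nat \<Rightarrow> real ^ 'd) measure"
  let ?U = "cube_measure :: (real ^ 'd) measure"
  interpret U: prob_space ?U by (rule prob_space_uniform_cube)
  interpret product_sigma_finite "\<lambda>_. ?U" by unfold_locales
  have "AE X in ?M. entrance_time X (insert u \<omega>) = entrance_time X (insert w (insert u \<omega>)) \<longrightarrow>
      entrance_time X (insert w \<omega>) = entrance_time X (insert w (insert u \<omega>)) \<longrightarrow>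
      entrance_time X \<omega> = entrance_time X (insert w (insert u \<omega>))" (is "AE X in ?M. ?P X")
    if \<omega>: "\<omega> \<in> Pow {..<n} - {{}}" and u: "u \<in> {..<n} - \<omega>" and w: "w \<in> {..<n} - insert u \<omega>"
    for \<omega> u w
  proof -
    let ?I = "{..<n} - {w}" and ?B = "{X \<in> space ?M. \<not> ?P X}"
    have fin: "finite \<omega>" using \<omega> finite_subset by auto
    have I: "finite ?I" "w \<notin> ?I" "insert w ?I = {..<n}" using w by auto
    have meas: "(\<lambda>X. entrance_time X \<omega>) \<in> borel_measurable ?M"
        "(\<lambda>X. entrance_time X (insert u \<omega>)) \<in> borel_measurable ?M"
        "(\<lambda>X. entrance_time X (insert w \<omega>)) \<in> borel_measurable ?M"
        "(\<lambda>X. entrance_time X (insert w (insert u \<omega>))) \<in> borel_measurable ?M"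
      using \<omega> u w by (auto intro!: measurable_entrance_time)
    have "{X \<in> space ?M. \<not> (f X = h X \<longrightarrow> g X = h X \<longrightarrow> e X = h X)} \<in> sets ?M"
      if [measurable]: "e \<in> borel_measurable ?M" "f \<in> borel_measurable ?M"
        "g \<in> borel_measurable ?M" "h \<in> borel_measurable ?M" for e f g h :: "_ \<Rightarrow> real"
      by (intro sets.sets_Collect_neg sets.sets_Collect_imp borel_measurable_eq that)
    from this[OF meas] have B: "?B \<in> sets ?M" .
    have PI: "Pi\<^sub>M (insert w ?I) (\<lambda>_. ?U) = ?M" by (simp only: I(3) uniform_points_def)
    have "emeasure ?M ?B = (\<integral>\<^sup>+ X. indicator ?B X \<partial>Pi\<^sub>M (insert w ?I) (\<lambda>_. ?U))"
      unfolding PI by (rule nn_integral_indicator[OF B, symmetric])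
    also have "\<dots> = (\<integral>\<^sup>+ x. (\<integral>\<^sup>+ y. indicator ?B (x(w := y)) \<partial>?U) \<partial>Pi\<^sub>M ?I (\<lambda>_. ?U))"
    proof (rule product_nn_integral_insert[OF I(1,2)])
      show "indicator ?B \<in> borel_measurable (Pi\<^sub>M (insert w ?I) (\<lambda>_. ?U))"
        unfolding PI by (rule borel_measurable_indicator[OF B])
    qed
    also have "\<dots> = (\<integral>\<^sup>+ x. 0 \<partial>Pi\<^sub>M ?I (\<lambda>_. ?U))"
    proof (rule nn_integral_cong)
      fix x :: "nat \<Rightarrow> real ^ 'd"
      obtain c where c: "\<forall>p\<in>insert u \<omega>. dist (x p) c \<le> entrance_time x (insert u \<omega>)"
        using ex_centre[of "insert u \<omega>" x] fin by auto
      have "y \<in> sphere c (entrance_time x (insert u \<omega>))" if y: "x(w := y) \<in> ?B" for y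
      proof -
        define Y where "Y = x(w := y)"
        have Y: "Y w = y" "\<forall>p\<in>insert u \<omega>. Y p = x p" using w by (auto simp: Y_def)
        have eq: "entrance_time Y (insert u \<omega>) = entrance_time x (insert u \<omega>)"
          using Y(2) by (intro entrance_time_cong) auto
        have "\<not> ?P Y" using y unfolding Y_def by blast
        moreover have "\<forall>p\<in>insert u \<omega>. dist (Y p) c \<le> entrance_time Y (insert u \<omega>)"
          using c Y(2) eq by simp
        moreover have "\<omega> \<noteq> {}" using \<omega> by blast
        ultimately have "dist (Y w) c = entrance_time Y (insert u \<omega>)"
          using non_generic_on_sphere[OF fin] by blast
        then show ?thesis by (simp add: Y(1) eq dist_commute)
      qed
      then have "(\<integral>\<^sup>+ y. indicator ?B (x(w := y)) \<partial>?U)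
          \<le> (\<integral>\<^sup>+ y. indicator (sphere c (entrance_time x (insert u \<omega>))) y \<partial>?U)"
        by (intro nn_integral_mono) (auto simp: indicator_def)
      also have "\<dots> = 0" by (simp add: emeasure_cube_measure_sphere del: emeasure_uniform_measure)
      finally show "(\<integral>\<^sup>+ y. indicator ?B (x(w := y)) \<partial>?U) = 0" by simp
    qed
    finally have "?B \<in> null_sets ?M" using B by (simp add: null_sets_def)
    then show ?thesis by (rule AE_I') auto
  qed
  then show ?thesis unfolding generic_points_def
    by (intro AE_finite_allI AE_conjI) auto
qed


section \<open>Counting points in the cells of a grid\<close>

definition grid_indices :: "nat \<Rightarrow> ('d::finite \<Rightarrow> nat) set" where
  "grid_indices m = {a. \<forall>i. a i < m}"

text \<open>For \<open>s = 0\<close> these are the cells of the subdivision of the unit cube into \<open>m ^ CARD('d)\<close> congruent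
  cubes; the parameter \<open>s\<close> widens a cell by \<open>s\<close> cell widths on each side.\<close>

definition grid_box :: "nat \<Rightarrow> real \<Rightarrow> ('d::finite \<Rightarrow> nat) \<Rightarrow> (real ^ 'd) set" where
  "grid_box m s a =
     cbox (\<chi> i. (real (a i) - s) / real m - 1 / 2) (\<chi> i. (real (a i) + 1 + s) / real m - 1 / 2)"

lemma grid_indices_PiE: "grid_indices m = (UNIV :: 'd::finite set) \<rightarrow>\<^sub>E {..<m}"
  by (auto simp: grid_indices_def PiE_def Pi_def extensional_def)

lemma finite_grid_indices: "finite (grid_indices m :: ('d::finite \<Rightarrow> nat) set)"
  unfolding grid_indices_PiE by (intro finite_PiE) auto

lemma card_grid_indices: "card (grid_indices m :: ('d::finite \<Rightarrow> nat) set) = m ^ CARD('d)"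
  unfolding grid_indices_PiE by (subst card_PiE) auto

lemma mem_grid_box:
  "x \<in> grid_box m s a \<longleftrightarrow>
    (\<forall>i. (real (a i) - s) / real m - 1 / 2 \<le> x $ i \<and> x $ i \<le> (real (a i) + 1 + s) / real m - 1 / 2)"
  by (simp add: grid_box_def mem_box_cart)

lemma measure_grid_box:
  fixes a :: "'d::finite \<Rightarrow> nat"
  assumes "m > 0" "s \<ge> 0"
  shows "measure lborel (grid_box m s a) = ((1 + 2 * s) / m) ^ CARD('d)"
proof -
  have "(\<chi> i. real (a i) / real m - 1 / 2) \<in> grid_box m s a"
    using assms by (auto simp: mem_grid_box divide_right_mono)
  then have "grid_box m s a \<noteq> {}" by blast
  then have "measure lborel (grid_box m s a) =
      (\<Prod>i\<in>UNIV. ((real (a i) + 1 + s) / m - 1 / 2) - ((real (a i) - s) / m - 1 / 2))"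
    unfolding grid_box_def by (subst content_cbox_cart) auto
  also have "\<dots> = (\<Prod>i\<in>(UNIV :: 'd set). (1 + 2 * s) / m)"
    by (intro prod.cong refl) (simp add: diff_divide_distrib[symmetric])
  finally show ?thesis by simp
qed

lemma grid_cell_subset:
  assumes "a \<in> grid_indices m"
  shows "grid_box m 0 a \<subseteq> unit_cube"
proof
  fix x assume x: "x \<in> grid_box m 0 a"
  show "x \<in> unit_cube"
    unfolding unit_cube_def mem_box_cart
  proof
    fix i
    have "a i < m" using assms by (simp add: grid_indices_def)
    then have "real (a i) / m \<ge> 0" "(real (a i) + 1) / m \<le> 1" by (auto simp: field_simps)
    moreover have "real (a i) / m - 1 / 2 \<le> x $ i" "x $ i \<le> (real (a i) + 1) / m - 1 / 2"
      using x by (auto simp: mem_grid_box)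
    ultimately show "(\<chi> i. - 1 / 2) $ i \<le> x $ i \<and> x $ i \<le> (\<chi> i. 1 / 2) $ i"
      unfolding vec_lambda_beta by linarith
  qed
qed

lemma grid_cell_cover:
  fixes x :: "real ^ 'd"
  assumes "x \<in> unit_cube" "m > 0"
  obtains a where "a \<in> grid_indices m" "x \<in> grid_box m 0 a"
proof -
  have "\<exists>j<m. real j / m - 1 / 2 \<le> x $ i \<and> x $ i \<le> (real j + 1) / m - 1 / 2" for i
  proof -
    define y where "y = (x $ i + 1 / 2) * m"
    have "-1 / 2 \<le> x $ i \<and> x $ i \<le> 1 / 2" using assms(1) by (simp add: unit_cube_def mem_box_cart)
    then have y: "0 \<le> y" "y \<le> m"
      using assms(2) mult_right_mono[of "x $ i + 1 / 2" 1 "real m"] by (auto simp: y_def)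
    have xi: "x $ i = y / m - 1 / 2" using assms(2) by (simp add: y_def)
    have "\<exists>j<m. real j \<le> y \<and> y \<le> real j + 1"
    \<comment> \<open>The last cell contains its right end.\<close>
    proof (cases "y = m")
      case True
      then show ?thesis using assms(2) by (intro exI[of _ "m - 1"]) auto
    next
      case False
      then show ?thesis using y by (intro exI[of _ "nat \<lfloor>y\<rfloor>"]) (auto, linarith+)
    qed
    then show ?thesis unfolding xi using assms(2) by (auto simp: divide_right_mono)
  qed
  then obtain a where "\<forall>i. a i < m \<and> real (a i) / m - 1 / 2 \<le> x $ i \<and> x $ i \<le> (real (a i) + 1) / m - 1 / 2"
    by metis
  then show thesis by (intro that[of a]) (auto simp: grid_indices_def mem_grid_box)
qed

lemma dist_grid_cell:
  fixes x y :: "real ^ 'd"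
  assumes "x \<in> grid_box m 0 a" "y \<in> grid_box m 0 a"
  shows "dist x y \<le> CARD('d) / m"
proof -
  have "dist x y \<le> (\<Sum>i\<in>UNIV. \<bar>(x - y) $ i\<bar>)" unfolding dist_norm by (rule norm_le_l1_cart)
  also have "\<dots> \<le> (\<Sum>i\<in>(UNIV :: 'd set). 1 / m)"
  proof (rule sum_mono)
    fix i
    have "(real (a i) + 1) / m = real (a i) / m + 1 / m" by (simp add: add_divide_distrib)
    moreover have "real (a i) / m - 1 / 2 \<le> x $ i \<and> x $ i \<le> (real (a i) + 1) / m - 1 / 2"
      "real (a i) / m - 1 / 2 \<le> y $ i \<and> y $ i \<le> (real (a i) + 1) / m - 1 / 2"
      using assms by (auto simp: mem_grid_box)
    ultimately show "\<bar>(x - y) $ i\<bar> \<le> 1 / m"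
      unfolding vector_minus_component by (intro abs_leI) linarith+
  qed
  finally show ?thesis by simp
qed

lemma near_grid_cell:
  fixes x y :: "real ^ 'd"
  assumes "x \<in> grid_box m 0 a" "dist x y \<le> s / m"
  shows "y \<in> grid_box m s a"
  unfolding mem_grid_box
proof
  fix i
  have shift: "l - e - 1 / 2 \<le> v \<and> v \<le> h + e - 1 / 2"
    if "l - 1 / 2 \<le> u" "u \<le> h - 1 / 2" "\<bar>u - v\<bar> \<le> e" for l h e u v :: real
    using that by linarith
  have "\<bar>x $ i - y $ i\<bar> \<le> s / m"
    using component_le_norm_cart[of "x - y" i] assms(2) by (simp add: dist_norm)
  moreover have "real (a i) / m - 1 / 2 \<le> x $ i" "x $ i \<le> (real (a i) + 1) / m - 1 / 2"
    using assms(1) by (auto simp: mem_grid_box)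
  ultimately show "(real (a i) - s) / m - 1 / 2 \<le> y $ i \<and> y $ i \<le> (real (a i) + 1 + s) / m - 1 / 2"
    unfolding diff_divide_distrib add_divide_distrib[of "real (a i) + 1"] by (intro shift[of _ "x $ i"])
qed


text \<open>Some cell contains at most \<open>k + 1\<close> points. The formulation by a set \<open>T\<close> of indices outside the
  cell makes the event a finite union of events to which \<open>prob_all_in\<close> applies.\<close>

definition sparse_config :: "nat \<Rightarrow> nat \<Rightarrow> nat \<Rightarrow> (nat \<Rightarrow> real ^ 'd) \<Rightarrow> bool" where
  "sparse_config n m k X \<longleftrightarrow>
    (\<exists>a\<in>grid_indices m. \<exists>T. T \<subseteq> {..<n} \<and> card T = n - (k + 1) \<and> (\<forall>i\<in>T. X i \<in> - grid_box m 0 a))"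

text \<open>Some cell, widened so that it contains every point at distance up to \<open>2 * CARD('d) / m\<close> from a
  point of the cell, contains at least \<open>t\<close> points.\<close>

definition crowded_config :: "nat \<Rightarrow> nat \<Rightarrow> nat \<Rightarrow> (nat \<Rightarrow> real ^ 'd) \<Rightarrow> bool" where
  "crowded_config n m t X \<longleftrightarrow>
    (\<exists>a\<in>grid_indices m. \<exists>T. T \<subseteq> {..<n} \<and> card T = t \<and> (\<forall>i\<in>T. X i \<in> grid_box m (2 * CARD('d)) a))"

lemma prob_sparse_config:
  assumes "m > 0"
  shows "{X \<in> space (uniform_points n). sparse_config n m k (X :: nat \<Rightarrow> real ^ 'd)} \<in> sets (uniform_points n)"
    and "measure (uniform_points n) {X \<in> space (uniform_points n). sparse_config n m k (X :: nat \<Rightarrow> real ^ 'd)}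
      \<le> real (m ^ CARD('d)) * real (n choose (n - (k + 1))) * (1 - 1 / real m ^ CARD('d)) ^ (n - (k + 1))"
proof -
  have box: "grid_box m 0 a \<in> sets borel" for a :: "'d \<Rightarrow> nat" by (simp add: grid_box_def)
  interpret U: prob_space "cube_measure :: (real ^ 'd) measure" by (rule prob_space_uniform_cube)
  have cell: "measure cube_measure (- grid_box m 0 a) \<le> 1 - 1 / real m ^ CARD('d)"
    if "a \<in> grid_indices m" for a :: "'d \<Rightarrow> nat"
  proof -
    have "measure cube_measure (grid_box m 0 a) = measure lborel (grid_box m 0 a)"
      using grid_cell_subset[OF that] box by (simp add: measure_cube_measure Int_absorb1)
    also have "\<dots> = 1 / real m ^ CARD('d)"
      using assms by (simp add: measure_grid_box power_one_over)
    finally show ?thesis using U.prob_compl[of "grid_box m 0 a"] box by (simp add: Compl_eq_Diff_UNIV)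
  qed
  note fin = finite_grid_indices[where m = m and 'd = 'd]
  note * = prob_ex_all_in[where I = "grid_indices m :: ('d \<Rightarrow> nat) set" and A = "\<lambda>a. - grid_box m 0 a"
      and n = n and t = "n - (k + 1)" and q = "1 - 1 / real m ^ CARD('d)", OF fin]
  show "{X \<in> space (uniform_points n). sparse_config n m k (X :: nat \<Rightarrow> real ^ 'd)} \<in> sets (uniform_points n)"
    unfolding sparse_config_def by (rule *(1)) (use box cell in auto)
  show "measure (uniform_points n) {X \<in> space (uniform_points n). sparse_config n m k (X :: nat \<Rightarrow> real ^ 'd)}
      \<le> real (m ^ CARD('d)) * real (n choose (n - (k + 1))) * (1 - 1 / real m ^ CARD('d)) ^ (n - (k + 1))"
    unfolding sparse_config_def card_grid_indices[where 'd = 'd, symmetric]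
    by (rule *(2)) (use box cell in auto)
qed

lemma prob_crowded_config:
  assumes "m > 0"
  shows "{X \<in> space (uniform_points n). crowded_config n m t (X :: nat \<Rightarrow> real ^ 'd)} \<in> sets (uniform_points n)"
    and "measure (uniform_points n) {X \<in> space (uniform_points n). crowded_config n m t (X :: nat \<Rightarrow> real ^ 'd)}
      \<le> real (m ^ CARD('d)) * real (n choose t) * (((1 + 4 * CARD('d)) / m) ^ CARD('d)) ^ t"
proof -
  let ?s = "real (2 * CARD('d))"
  have box: "grid_box m ?s a \<in> sets borel" for a :: "'d \<Rightarrow> nat" by (simp add: grid_box_def)
  have block: "measure cube_measure (grid_box m ?s a) \<le> ((1 + 4 * CARD('d)) / m) ^ CARD('d)" for a :: "'d \<Rightarrow> nat"
  proof -
    have "measure cube_measure (grid_box m ?s a) \<le> measure lborel (grid_box m ?s a)"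
      unfolding measure_cube_measure[OF box]
      by (rule measure_mono_fmeasurable) (auto simp: grid_box_def)
    also have "\<dots> = ((1 + 2 * ?s) / m) ^ CARD('d)" using assms by (intro measure_grid_box) auto
    finally show ?thesis by simp
  qed
  note fin = finite_grid_indices[where m = m and 'd = 'd]
  note * = prob_ex_all_in[where I = "grid_indices m :: ('d \<Rightarrow> nat) set" and A = "\<lambda>a. grid_box m ?s a"
      and n = n and t = t and q = "((1 + 4 * CARD('d)) / m) ^ CARD('d)", OF fin box block]
  show "{X \<in> space (uniform_points n). crowded_config n m t (X :: nat \<Rightarrow> real ^ 'd)} \<in> sets (uniform_points n)"
    unfolding crowded_config_def using *(1) by simp
  show "measure (uniform_points n) {X \<in> space (uniform_points n). crowded_config n m t (X :: nat \<Rightarrow> real ^ 'd)}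
      \<le> real (m ^ CARD('d)) * real (n choose t) * (((1 + 4 * CARD('d)) / m) ^ CARD('d)) ^ t"
    unfolding crowded_config_def card_grid_indices[where 'd = 'd, symmetric]
    using *(2) by simp
qed

text \<open>The projection to a convex set that contains the points does not increase any distance to
  them.\<close>

lemma centre_in_cube:
  fixes X :: "nat \<Rightarrow> real ^ 'd"
  assumes "finite \<sigma>" "\<sigma> \<noteq> {}" "\<forall>p\<in>\<sigma>. X p \<in> unit_cube"
  obtains c where "c \<in> unit_cube" "\<forall>p\<in>\<sigma>. dist (X p) c \<le> entrance_time X \<sigma>"
proof -
  obtain c where c: "\<forall>p\<in>\<sigma>. dist (X p) c \<le> entrance_time X \<sigma>" using ex_centre[OF assms(1,2)] .
  let ?C = "unit_cube :: (real ^ 'd) set"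
  have ne: "?C \<noteq> {}" using assms(2,3) by auto
  have cv: "convex ?C" "closed ?C" by (simp_all add: unit_cube_def convex_box closed_cbox)
  have "dist (X p) (closest_point ?C c) \<le> dist (X p) c" if "p \<in> \<sigma>" for p
    using closest_point_lipschitz[OF cv ne, of "X p" c] closest_point_self[of "X p" ?C] assms(3) that by simp
  then have "\<forall>p\<in>\<sigma>. dist (X p) (closest_point ?C c) \<le> entrance_time X \<sigma>" using c by force
  then show thesis using that closest_point_in_set[OF cv(2) ne] by blast
qed

text \<open>A ball of radius \<open>CARD('d) / m\<close> around the centre contains the whole cell of the centre, and that cell has
  a point that is not a vertex of \<open>\<sigma>\<close>.\<close>

lemma empty_simplex_small:
  fixes X :: "nat \<Rightarrow> real ^ 'd"
  assumes "m > 0" "\<not> sparse_config n m k X" "\<forall>i<n. X i \<in> unit_cube"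
    and \<sigma>: "\<sigma> \<subseteq> {..<n}" "card \<sigma> = k + 1"
    and empty: "\<forall>v<n. v \<notin> \<sigma> \<longrightarrow> entrance_time X \<sigma> < entrance_time X (insert v \<sigma>)"
  shows "entrance_time X \<sigma> \<le> CARD('d) / m"
proof (rule ccontr)
  assume large: "\<not> ?thesis"
  have fin: "finite \<sigma>" "\<sigma> \<noteq> {}" using \<sigma> finite_subset by auto
  obtain c where c: "c \<in> unit_cube" "\<forall>p\<in>\<sigma>. dist (X p) c \<le> entrance_time X \<sigma>"
    using centre_in_cube[OF fin, of X] assms(3) \<sigma>(1) by blast
  obtain a where a: "a \<in> grid_indices m" "c \<in> grid_box m 0 a" using grid_cell_cover[OF c(1) assms(1)] .
  have "card ({..<n} - \<sigma>) = n - (k + 1)" using \<sigma> fin by (simp add: card_Diff_subset)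
  then obtain v where v: "v < n" "v \<notin> \<sigma>" "X v \<in> grid_box m 0 a"
    using assms(2) a(1) unfolding sparse_config_def by (metis Compl_iff Diff_iff Diff_subset lessThan_iff)
  have "dist (X v) c \<le> CARD('d) / m" using dist_grid_cell v(3) a(2) .
  then have "entrance_time X (insert v \<sigma>) \<le> entrance_time X \<sigma>"
    using c(2) large fin by (intro entrance_time_le[of _ X c]) auto
  then show False using empty v by force
qed

text \<open>A simplex is determined by its smallest vertex and the set of its other vertices, which are
  within distance \<open>2 * CARD('d) / m\<close> of that vertex; there are at most \<open>t\<close> candidates for them.\<close>

lemma card_small_simplices:
  fixes X :: "nat \<Rightarrow> real ^ 'd"
  assumes "m > 0" "\<not> crowded_config n m t X" "\<forall>i<n. X i \<in> unit_cube"
  shows "card {\<sigma>. \<sigma> \<subseteq> {..<n} \<and> card \<sigma> = k + 1 \<and> entrance_time X \<sigma> \<le> CARD('d) / m} \<le> n * t ^ k"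
proof -
  define N where "N p = {i. i < n \<and> dist (X p) (X i) \<le> 2 * CARD('d) / m}" for p
  let ?S = "{\<sigma>. \<sigma> \<subseteq> {..<n} \<and> card \<sigma> = k + 1 \<and> entrance_time X \<sigma> \<le> CARD('d) / m}"
  let ?T = "SIGMA p:{..<n}. {S. S \<subseteq> N p \<and> card S = k}"
  have finN: "finite (N p)" for p by (simp add: N_def)
  have Nt: "card (N p) \<le> t" if p: "p < n" for p
  proof (rule ccontr)
    assume "\<not> card (N p) \<le> t"
    then obtain T where T: "T \<subseteq> N p" "card T = t" by (meson nat_le_linear obtain_subset_with_card_n)
    obtain a where a: "a \<in> grid_indices m" "X p \<in> grid_box m 0 a"
      using grid_cell_cover[of "X p" m] assms(1,3) p by blast
    have "X i \<in> grid_box m (2 * CARD('d)) a" if "i \<in> T" for i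
      using near_grid_cell[OF a(2), of "X i"] T that by (auto simp: N_def)
    moreover have "T \<subseteq> {..<n}" using T by (auto simp: N_def)
    ultimately show False using assms(2) T(2) a(1) unfolding crowded_config_def by blast
  qed
  have "card ?S \<le> card ?T"
  proof (rule card_inj_on_le[of "\<lambda>\<sigma>. (Min \<sigma>, \<sigma> - {Min \<sigma>})"])
    have Min: "finite \<sigma>" "Min \<sigma> \<in> \<sigma>" if "\<sigma> \<in> ?S" for \<sigma>
    proof -
      show "finite \<sigma>" using that finite_subset by auto
      then show "Min \<sigma> \<in> \<sigma>" using that by (intro Min_in) auto
    qed
    show "inj_on (\<lambda>\<sigma>. (Min \<sigma>, \<sigma> - {Min \<sigma>})) ?S"
    proof (rule inj_onI)
      fix \<sigma> \<tau> assume \<sigma>\<tau>: "\<sigma> \<in> ?S" "\<tau> \<in> ?S"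
        and "(Min \<sigma>, \<sigma> - {Min \<sigma>}) = (Min \<tau>, \<tau> - {Min \<tau>})"
      then have "Min \<sigma> = Min \<tau>" "\<sigma> - {Min \<sigma>} = \<tau> - {Min \<tau>}" by blast+
      then show "\<sigma> = \<tau>" using insert_Diff[OF Min(2)[OF \<sigma>\<tau>(1)]] insert_Diff[OF Min(2)[OF \<sigma>\<tau>(2)]] by simp
    qed
    show "(\<lambda>\<sigma>. (Min \<sigma>, \<sigma> - {Min \<sigma>})) ` ?S \<subseteq> ?T"
    proof (rule image_subsetI)
      fix \<sigma> assume \<sigma>: "\<sigma> \<in> ?S"
      note M = Min[OF \<sigma>]
      obtain c where c: "\<forall>p\<in>\<sigma>. dist (X p) c \<le> entrance_time X \<sigma>"
        using ex_centre[of \<sigma> X] M by blast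
      have "dist (X (Min \<sigma>)) (X i) \<le> 2 * CARD('d) / m" if "i \<in> \<sigma>" for i
      proof -
        have "entrance_time X \<sigma> \<le> CARD('d) / m" using \<sigma> by simp
        moreover have "dist (X (Min \<sigma>)) c \<le> entrance_time X \<sigma>" "dist (X i) c \<le> entrance_time X \<sigma>"
          using c M(2) that by blast+
        moreover have "2 * CARD('d) / m = CARD('d) / m + CARD('d) / m" by simp
        ultimately show ?thesis using dist_triangle2[of "X (Min \<sigma>)" "X i" c] by linarith
      qed
      then show "(Min \<sigma>, \<sigma> - {Min \<sigma>}) \<in> ?T" using \<sigma> M by (auto simp: N_def)
    qed
    show "finite ?T" using finN by auto
  qed
  also have "\<dots> = (\<Sum>p<n. card (N p) choose k)" using finN by (simp add: n_subsets)
  also have "\<dots> \<le> (\<Sum>p<n. t ^ k)"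
  proof (rule sum_mono)
    fix p assume "p \<in> {..<n}"
    then have "card (N p) ^ k \<le> t ^ k" using Nt by (intro power_mono) auto
    moreover have "card (N p) choose k \<le> card (N p) ^ k"
      by (cases "k \<le> card (N p)") (simp_all only: binomial_le_pow binomial_eq_0 not_le zero_le)
    ultimately show "card (N p) choose k \<le> t ^ k" by linarith
  qed
  finally show ?thesis by simp
qed

text \<open>Almost surely the points are generic and lie in the cube. Then \<open>fill_in_bound\<close> applies with
  \<open>r = CARD('d) / m\<close> unless the configuration is sparse or crowded, and in these cases the fill-in is
  at most the square of the number of rows.\<close>

lemma expected_fill_in_bound:
  fixes n k m t :: nat
  assumes "k \<ge> 1" "m > 0"
  defines "P \<equiv> measure (uniform_points n) {X \<in> space (uniform_points n). sparse_config n m k (X :: nat \<Rightarrow> real ^ 'd)}"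
    and "Q \<equiv> measure (uniform_points n) {X \<in> space (uniform_points n). crowded_config n m t (X :: nat \<Rightarrow> real ^ 'd)}"
  shows "(\<integral>X. real (nnz_mat (reduced_matrix (cech_boundary_matrix n X k)))
            \<partial>(uniform_points n :: (nat \<Rightarrow> real ^ 'd) measure))
    \<le> (k + 2) * real n ^ (k + 1) + (real n * real t ^ k)\<^sup>2 + real n ^ (2 * (k + 1)) * (P + Q)"
proof -
  let ?M = "uniform_points n :: (nat \<Rightarrow> real ^ 'd) measure"
  interpret prob_space ?M by (rule prob_space_uniform_points)
  let ?S = "{X \<in> space ?M. sparse_config n m k X}" and ?C = "{X \<in> space ?M. crowded_config n m t X}"
  let ?f = "\<lambda>X. real (nnz_mat (reduced_matrix (cech_boundary_matrix n X k)))"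
  let ?g = "\<lambda>X. (k + 2) * real n ^ (k + 1) + (real n * real t ^ k)\<^sup>2
    + real n ^ (2 * (k + 1)) * (indicator ?S X + indicator ?C X)"
  note sets = prob_sparse_config(1)[OF assms(2), where 'd = 'd and n = n and k = k]
    prob_crowded_config(1)[OF assms(2), where 'd = 'd and n = n and t = t]
  have bound: "?f X \<le> ?g X"
    if X: "X \<in> space ?M" "generic_points n X" "\<forall>i<n. X i \<in> unit_cube" for X
  proof -
    interpret cech_reduction n k X .
    have "card (set faces) = n choose (k + 1)"
      using n_subsets[of "{..<n}" "k + 1"] by (simp add: set_faces)
    also have "\<dots> \<le> n ^ (k + 1)"
      by (cases "k + 1 \<le> n") (simp_all only: binomial_le_pow binomial_eq_0 not_le zero_le)
    finally have faces: "card (set faces) \<le> n ^ (k + 1)" .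
    show ?thesis
    proof (cases "sparse_config n m k X \<or> crowded_config n m t X")
      case True
      have "nnz_mat (reduced_matrix M) \<le> n ^ (k + 1) * n ^ (k + 1)"
        using fill_in_trivial mult_le_mono[OF faces faces] by linarith
      also have "\<dots> = n ^ (2 * (k + 1))" by (simp only: mult_2 power_add)
      finally have "?f X \<le> real (n ^ (2 * (k + 1)))" unfolding M_def by (simp only: of_nat_le_iff)
      also have "\<dots> \<le> real n ^ (2 * (k + 1)) * (indicator ?S X + indicator ?C X)"
        using True X(1) by (auto simp: indicator_def)
      finally show ?thesis by (smt (verit) mult_nonneg_nonneg of_nat_0_le_iff zero_le_power zero_le_power2)
    next
      case False
      let ?small = "card {\<sigma> \<in> set faces. entrance_time X \<sigma> \<le> CARD('d) / m}"
      have "nnz_mat (reduced_matrix M) \<le> (k + 2) * card (set faces) + ?small\<^sup>2"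
        using empty_simplex_small[of m n k X] False assms(1,2) X
        by (intro fill_in_bound) (auto simp: set_faces)
      also have "\<dots> \<le> (k + 2) * n ^ (k + 1) + (n * t ^ k)\<^sup>2"
        using faces card_small_simplices[of m n t X k] False assms(2) X
        by (intro add_mono mult_le_mono2 power_mono) (auto simp: set_faces conj_assoc)
      finally have "?f X \<le> real ((k + 2) * n ^ (k + 1) + (n * t ^ k)\<^sup>2)"
        unfolding M_def by (simp only: of_nat_le_iff)
      then show ?thesis using False by (simp add: algebra_simps)
    qed
  qed
  have "(\<integral>X. ?f X \<partial>?M) \<le> (\<integral>X. ?g X \<partial>?M)"
  proof (rule integral_mono_AE)
    show "integrable ?M ?f"
      by (rule integrable_cech_boundary_matrix[where f = "\<lambda>A. real (nnz_mat (reduced_matrix A))"])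
    show "integrable ?M ?g"
      by (intro Bochner_Integration.integrable_add integrable_mult_right integrable_const
          integrable_real_indicator sets) (simp_all add: emeasure_eq_measure)
    show "AE X in ?M. ?f X \<le> ?g X"
      using AE_generic_points AE_in_cube AE_space by eventually_elim (rule bound)
  qed
  also have "(\<integral>X. ?g X \<partial>?M) = (k + 2) * real n ^ (k + 1) + (real n * real t ^ k)\<^sup>2
      + real n ^ (2 * (k + 1)) * (P + Q)"
  proof -
    have "integrable ?M (indicator ?S :: _ \<Rightarrow> real)" "integrable ?M (indicator ?C :: _ \<Rightarrow> real)"
      using sets by (auto intro!: integrable_real_indicator simp: emeasure_eq_measure)
    moreover have "expectation (indicator ?S) = P" "expectation (indicator ?C) = Q"
      using sets unfolding P_def Q_def by auto
    ultimately show ?thesis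
      by (simp only: Bochner_Integration.integral_add Bochner_Integration.integrable_add
          integral_mult_right_zero integrable_mult_right integrable_const lebesgue_integral_const
          prob_space scaleR_one)
  qed
  finally show ?thesis .
qed

section \<open>The choice of the grid and the asymptotic bounds\<close>

lemma power_div_fact_le_exp:
  fixes x :: real
  assumes "x \<ge> 0"
  shows "x ^ t / fact t \<le> exp x"
proof -
  have "(\<lambda>n. x ^ n / fact n) sums exp x" using exp_converges[of x] by (simp add: divide_inverse_commute)
  from sum_le_suminf[OF sums_summable[OF this], of "{t}"] sums_unique[OF this] assms
  show ?thesis by simp
qed

lemma grid_resolution:
  fixes y :: real
  assumes "y \<ge> 1" "d > 0"
  obtains m :: nat where "m > 0" "real m ^ d \<le> y" "y \<le> (2 * real m) ^ d"
proof -
  let ?z = "root d y"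
  have z: "?z ^ d = y" "?z \<ge> 1" using assms by (simp_all add: real_root_pow_pos2)
  let ?m = "nat \<lfloor>?z\<rfloor>"
  have m: "?m > 0" "real ?m \<le> ?z" "?z \<le> 2 * real ?m"
  proof -
    have "1 \<le> \<lfloor>?z\<rfloor>" using z(2) by (simp add: le_floor_iff)
    then show "?m > 0" "real ?m \<le> ?z" "?z \<le> 2 * real ?m" by linarith+
  qed
  have "real ?m ^ d \<le> y" "y \<le> (2 * real ?m) ^ d"
    using m z power_mono[of "real ?m" ?z d] power_mono[of ?z "2 * real ?m" d] by auto
  with m(1) show thesis by (rule that)
qed

lemma exp_minus_mult_ln:
  assumes "x > 0"
  shows "exp (- (real c * ln x)) = 1 / x ^ c"
  using assms by (simp add: exp_minus exp_of_nat_mult divide_inverse)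

text \<open>The cells have volume \<open>1 / D \<ge> 2 * (2 * k + 3) * ln n / n\<close>. At least \<open>n / 2\<close> points have to miss a
  cell, which has probability at most \<open>n powr - (2 * k + 3)\<close>; the union bound costs
  \<open>n ^ (k + 2)\<close>.\<close>

lemma sparse_bound_le:
  fixes D :: real
  assumes "1 \<le> D" "D * (2 * real (2 * k + 3) * ln n) \<le> n" "n \<ge> 2 * (k + 1)" "ln n \<ge> 1"
  shows "D * real (n choose (n - (k + 1))) * (1 - 1 / D) ^ (n - (k + 1)) \<le> 1 / real n ^ (k + 1)"
proof -
  let ?N = "n - (k + 1)"
  have n: "n > 0" "real ?N \<ge> n / 2" using assms(3) by auto
  have "1 * 1 \<le> 2 * real (2 * k + 3) * ln n" using assms(4) by (intro mult_mono) auto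
  then have "D * 1 \<le> D * (2 * real (2 * k + 3) * ln n)" using assms(1) by (intro mult_left_mono) auto
  then have Dn: "D \<le> n" using assms(2) by simp
  have "n choose ?N = n choose (k + 1)" using assms(3) by (intro binomial_symmetric[symmetric]) auto
  then have ch: "real (n choose ?N) \<le> real n ^ (k + 1)"
    using binomial_le_pow[of "k + 1" n] assms(3) by (metis of_nat_le_iff of_nat_power add_leD1 mult_2)
  have "1 - 1 / D \<le> exp (- (1 / D))" using exp_ge_add_one_self[of "- (1 / D)"] by simp
  then have "(1 - 1 / D) ^ ?N \<le> exp (- (1 / D)) ^ ?N" using assms(1) by (intro power_mono) auto
  also have "\<dots> = exp (- (real ?N / D))" by (simp add: exp_of_nat_mult[symmetric])
  also have "\<dots> \<le> exp (- (real (2 * k + 3) * ln n))"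
  proof -
    have "real (2 * k + 3) * ln n * D \<le> real n / 2" using assms(2) by (simp add: algebra_simps)
    also have "\<dots> \<le> real ?N" by (rule n(2))
    finally show ?thesis using assms(1) by (simp add: pos_le_divide_eq)
  qed
  also have "\<dots> = 1 / real n ^ (2 * k + 3)" using n by (intro exp_minus_mult_ln) auto
  finally have "D * real (n choose ?N) * (1 - 1 / D) ^ ?N \<le> real n * real n ^ (k + 1) * (1 / real n ^ (2 * k + 3))"
    using Dn ch assms(1) by (intro mult_mono) auto
  also have "\<dots> = 1 / real n ^ (k + 1)"
  proof -
    have "real n ^ (2 * k + 3) = real n * real n ^ (k + 1) * real n ^ (k + 1)"
    proof -
      have "2 * k + 3 = 1 + (k + 1) + (k + 1)" by simp
      then show ?thesis by (simp only: power_add power_one_right)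
    qed
    then show ?thesis using n by simp
  qed
  finally show ?thesis .
qed

text \<open>Chernoff's bound in the form \<open>(n choose t) * q ^ t \<le> (n * q) ^ t / fact t \<le> exp (exp 1 * n * q - t)\<close>.\<close>

lemma crowded_bound_le:
  fixes D q :: real
  assumes "0 \<le> D" "D \<le> n" "0 \<le> q" "n > 0" "real t \<ge> 3 * (n * q) + real (k + 2) * ln n"
  shows "D * real (n choose t) * q ^ t \<le> 1 / real n ^ (k + 1)"
proof -
  let ?x = "real n * q"
  have "real (n choose t) * fact t \<le> real n ^ t"
    using binomial_fact_pow[of n t] by (metis of_nat_fact of_nat_le_iff of_nat_mult of_nat_power)
  then have "real (n choose t) \<le> real n ^ t / fact t" by (simp add: pos_le_divide_eq)
  then have "real (n choose t) * q ^ t \<le> real n ^ t / fact t * q ^ t"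
    using assms by (intro mult_right_mono) auto
  also have "\<dots> = exp (- real t) * ((exp 1 * ?x) ^ t / fact t)"
    by (simp add: power_mult_distrib exp_minus exp_of_nat_mult[symmetric])
  also have "\<dots> \<le> exp (- real t) * exp (exp 1 * ?x)"
    using assms by (intro mult_left_mono power_div_fact_le_exp) auto
  also have "\<dots> = exp (exp 1 * ?x - real t)" by (simp add: exp_diff exp_minus field_simps)
  also have "\<dots> \<le> exp (- (real (k + 2) * ln n))"
  proof -
    have "exp 1 * ?x \<le> 3 * ?x" using assms exp_le by (intro mult_right_mono) auto
    then show ?thesis using assms(5) by simp
  qed
  also have "\<dots> = 1 / real n ^ (k + 2)" using assms by (intro exp_minus_mult_ln) auto
  finally have "D * (real (n choose t) * q ^ t) \<le> real n * (1 / real n ^ (k + 2))"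
    using assms by (intro mult_mono) auto
  then show ?thesis using assms by (simp add: mult.assoc)
qed

text \<open>The exceptional probabilities must be \<open>O(n powr - (k + 1))\<close>, as they are multiplied by
  \<open>n ^ (2 * k + 2)\<close>. This determines \<open>C\<close>, which fixes the volume of the cells as about
  \<open>C * ln n / n\<close>; then \<open>B * ln n\<close> bounds the expected number of points in a widened cell, and
  \<open>A * ln n\<close> the threshold \<open>t\<close> for crowdedness.\<close>

lemma expected_fill_in_eventually:
  assumes "k \<ge> 1"
  shows "\<exists>A\<ge>0. \<forall>\<^sub>F n in sequentially.
    (\<integral>X. real (nnz_mat (reduced_matrix (cech_boundary_matrix n X k)))
        \<partial>(uniform_points n :: (nat \<Rightarrow> real ^ 'd) measure))
    \<le> A * (real n ^ 2 * ln (real n) ^ (2 * k) + real n ^ (k + 1))"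
proof -
  define C where "C = 2 * real (2 * k + 3)"
  define d where "d = CARD('d)"
  define B where "B = 2 ^ d * (1 + 4 * real d) ^ d * C"
  define A where "A = 3 * B + real (k + 2) + 1"
  have C: "C > 0" and B: "B > 0" and A: "A \<ge> 1" by (auto simp: C_def B_def A_def)
  have "\<forall>\<^sub>F n in sequentially. 1 \<le> real n / (C * ln (real n))" using C by real_asymp
  moreover have "\<forall>\<^sub>F n in sequentially. 1 \<le> ln (real n)" by real_asymp
  moreover have "\<forall>\<^sub>F n in sequentially. 2 * (k + 1) \<le> n" by (rule eventually_ge_at_top)
  ultimately have "\<forall>\<^sub>F n in sequentially.
    (\<integral>X. real (nnz_mat (reduced_matrix (cech_boundary_matrix n X k)))
        \<partial>(uniform_points n :: (nat \<Rightarrow> real ^ 'd) measure))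
    \<le> (A ^ (2 * k) + real (k + 4)) * (real n ^ 2 * ln (real n) ^ (2 * k) + real n ^ (k + 1))"
  proof eventually_elim
    case (elim n)
    define L where "L = ln (real n)"
    have L: "L \<ge> 1" using elim by (simp add: L_def)
    have n: "real n > 0" using elim(3) by simp
    obtain m :: nat where m: "m > 0" "real m ^ d \<le> n / (C * L)" "n / (C * L) \<le> (2 * real m) ^ d"
      using grid_resolution[of "n / (C * L)" d] elim(1) by (auto simp: L_def d_def)
    define t where "t = nat \<lceil>3 * (B * L) + real (k + 2) * L\<rceil>"
    have BL: "3 * (B * L) + real (k + 2) * L \<ge> 0" using B L by simp
    have t: "3 * (B * L) + real (k + 2) * L \<le> real t" unfolding t_def by (rule real_nat_ceiling_ge)
    have "real t \<le> 3 * (B * L) + real (k + 2) * L + 1" using BL unfolding t_def by linarith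
    also have "\<dots> \<le> A * L" using L by (simp add: A_def algebra_simps)
    finally have tA: "real t \<le> A * L" .
    have Dn: "real m ^ d * (C * L) \<le> n" using m(2) C L by (simp add: pos_le_divide_eq)
    have D1: "1 \<le> real m ^ d" using m(1) by simp
    have "1 * 1 \<le> C * L" using L by (intro mult_mono) (auto simp: C_def)
    then have "real m ^ d * 1 \<le> real m ^ d * (C * L)" by (intro mult_left_mono) auto
    then have Dn': "real m ^ d \<le> n" using Dn by linarith
    let ?P = "measure (uniform_points n) {X \<in> space (uniform_points n). sparse_config n m k (X :: nat \<Rightarrow> real ^ 'd)}"
    let ?Q = "measure (uniform_points n) {X \<in> space (uniform_points n). crowded_config n m t (X :: nat \<Rightarrow> real ^ 'd)}"
    have "?P \<le> real m ^ d * real (n choose (n - (k + 1))) * (1 - 1 / real m ^ d) ^ (n - (k + 1))"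
      using prob_sparse_config(2)[OF m(1), of n k, where 'd = 'd] by (simp add: d_def)
    also have "\<dots> \<le> 1 / real n ^ (k + 1)"
      using D1 Dn elim by (intro sparse_bound_le) (auto simp: C_def L_def)
    finally have P: "?P \<le> 1 / real n ^ (k + 1)" .
    have q: "real n * ((1 + 4 * real d) / m) ^ d \<le> B * L"
    proof -
      have "real n \<le> (2 * real m) ^ d * (C * L)" using m(3) C L by (simp add: pos_divide_le_eq)
      then have "real n * ((1 + 4 * real d) / m) ^ d \<le> (2 * real m) ^ d * (C * L) * ((1 + 4 * real d) / m) ^ d"
        by (intro mult_right_mono) auto
      also have "\<dots> = B * L" using m(1) by (simp add: B_def power_mult_distrib power_divide)
      finally show ?thesis .
    qed
    have "?Q \<le> real m ^ d * real (n choose t) * (((1 + 4 * real d) / m) ^ d) ^ t"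
      using prob_crowded_config(2)[OF m(1), of n t, where 'd = 'd] by (simp add: d_def)
    also have "\<dots> \<le> 1 / real n ^ (k + 1)"
      using Dn' q t n by (intro crowded_bound_le) (auto simp: L_def)
    finally have Q: "?Q \<le> 1 / real n ^ (k + 1)" .
    have "(\<integral>X. real (nnz_mat (reduced_matrix (cech_boundary_matrix n X k)))
        \<partial>(uniform_points n :: (nat \<Rightarrow> real ^ 'd) measure))
      \<le> (k + 2) * real n ^ (k + 1) + (real n * real t ^ k)\<^sup>2 + real n ^ (2 * (k + 1)) * (?P + ?Q)"
      using expected_fill_in_bound[OF assms m(1), where 'd = 'd] .
    also have "\<dots> \<le> (k + 2) * real n ^ (k + 1) + (real n * (A * L) ^ k)\<^sup>2
        + real n ^ (2 * (k + 1)) * (1 / real n ^ (k + 1) + 1 / real n ^ (k + 1))"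
      using P Q tA by (intro add_mono mult_left_mono power_mono order_refl) auto
    also have "\<dots> = real (k + 4) * real n ^ (k + 1) + A ^ (2 * k) * (real n ^ 2 * L ^ (2 * k))"
    proof -
      have "real n ^ (2 * (k + 1)) * (1 / real n ^ (k + 1) + 1 / real n ^ (k + 1)) = 2 * real n ^ (k + 1)"
      proof -
        have cancel: "x * x * (1 / x + 1 / x) = 2 * x" if "x > 0" for x :: real
          using that by (simp add: field_simps)
        have "real n ^ (2 * (k + 1)) = real n ^ (k + 1) * real n ^ (k + 1)"
          by (simp only: mult_2 power_add)
        then show ?thesis using cancel[of "real n ^ (k + 1)"] n by simp
      qed
      moreover have "(real n * (A * L) ^ k)\<^sup>2 = A ^ (2 * k) * (real n ^ 2 * L ^ (2 * k))"
        by (simp only: power_mult_distrib power_even_eq) (simp only: mult_ac)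
      moreover have "real (k + 4) = real (k + 2) + 2" by simp
      ultimately show ?thesis by (simp only: distrib_right add_ac)
    qed
    also have "\<dots> \<le> (A ^ (2 * k) + real (k + 4)) * (real n ^ 2 * L ^ (2 * k) + real n ^ (k + 1))"
    proof -
      have "0 \<le> A ^ (2 * k) * real n ^ (k + 1)" "0 \<le> real (k + 4) * (real n ^ 2 * L ^ (2 * k))"
        using A L by auto
      then show ?thesis by (simp only: distrib_left distrib_right)
    qed
    finally show ?case by (simp only: L_def)
  qed
  moreover have "0 \<le> A ^ (2 * k) + real (k + 4)" using A by simp
  ultimately show ?thesis by blast
qed

lemma expected_cost_le_fill_in:
  "(\<integral>X. real (reduction_cost (cech_boundary_matrix n X k))
        \<partial>(uniform_points n :: (nat \<Rightarrow> real ^ 'd) measure))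
   \<le> real n ^ (k + 2) * (\<integral>X. real (nnz_mat (reduced_matrix (cech_boundary_matrix n X k)))
        \<partial>(uniform_points n :: (nat \<Rightarrow> real ^ 'd) measure))"
proof -
  let ?M = "uniform_points n :: (nat \<Rightarrow> real ^ 'd) measure"
  let ?D = "\<lambda>X :: nat \<Rightarrow> real ^ 'd. cech_boundary_matrix n X k"
  have "real (reduction_cost (?D X)) \<le> real n ^ (k + 2) * real (nnz_mat (reduced_matrix (?D X)))" for X
  proof -
    have "dim_col (?D X) = n choose (k + 2)"
      by (simp add: cech_boundary_matrix_def boundary_matrix_def rho_lex_list_props(4))
    also have "\<dots> \<le> n ^ (k + 2)"
      by (cases "k + 2 \<le> n") (simp_all only: binomial_le_pow binomial_eq_0 not_le zero_le)
    finally have "dim_col (?D X) * nnz_mat (reduced_matrix (?D X)) \<le> n ^ (k + 2) * nnz_mat (reduced_matrix (?D X))"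
      by (rule mult_le_mono1)
    then have "reduction_cost (?D X) \<le> n ^ (k + 2) * nnz_mat (reduced_matrix (?D X))"
      using reduction_cost_le_fill_in order_trans by blast
    then show ?thesis by (metis of_nat_le_iff of_nat_mult of_nat_power)
  qed
  then have "(\<integral>X. real (reduction_cost (?D X)) \<partial>?M)
      \<le> (\<integral>X. real n ^ (k + 2) * real (nnz_mat (reduced_matrix (?D X))) \<partial>?M)"
    by (intro integral_mono
        integrable_cech_boundary_matrix[where f = "\<lambda>A. real (reduction_cost A)"]
        integrable_cech_boundary_matrix[where f = "\<lambda>A. real n ^ (k + 2) * real (nnz_mat (reduced_matrix A))"])
  then show ?thesis by simp
qed

theorem theorem1:
  fixes k :: nat
  assumes "k \<ge> 1"
  shows "(\<lambda>n. \<integral>X. real (nnz_mat (reduced_matrix (cech_boundary_matrix n X k)))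
            \<partial>(uniform_points n :: (nat \<Rightarrow> real ^ 'd) measure))
          \<in> O(\<lambda>n. real n ^ 2 * ln (real n) ^ (2 * k) + real n ^ (k + 1))
    \<and> (\<lambda>n. \<integral>X. real (reduction_cost (cech_boundary_matrix n X k))
            \<partial>(uniform_points n :: (nat \<Rightarrow> real ^ 'd) measure))
          \<in> O(\<lambda>n. real n ^ (k + 4) * ln (real n) ^ (2 * k) + real n ^ (2 * k + 3))"
proof -
  let ?F = "\<lambda>n. \<integral>X. real (nnz_mat (reduced_matrix (cech_boundary_matrix n X k)))
            \<partial>(uniform_points n :: (nat \<Rightarrow> real ^ 'd) measure)"
  let ?C = "\<lambda>n. \<integral>X. real (reduction_cost (cech_boundary_matrix n X k))
            \<partial>(uniform_points n :: (nat \<Rightarrow> real ^ 'd) measure)"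
  let ?g = "\<lambda>n. real n ^ 2 * ln (real n) ^ (2 * k) + real n ^ (k + 1)"
  obtain A where A: "A \<ge> 0" "\<forall>\<^sub>F n in sequentially. ?F n \<le> A * ?g n"
    using expected_fill_in_eventually[OF assms, where 'd = 'd] by blast
  have g: "?g n \<ge> 0" for n by (simp add: power_mult)
  have F: "?F n \<ge> 0" and C: "?C n \<ge> 0" for n by (simp_all add: integral_nonneg_AE)
  have "?F \<in> O(?g)"
    using A(2) by (intro bigoI[of _ A]) (elim eventually_mono, use F g in auto)
  moreover have "?C \<in> O(\<lambda>n. real n ^ (k + 4) * ln (real n) ^ (2 * k) + real n ^ (2 * k + 3))"
  proof (rule bigoI[of _ A])
    show "\<forall>\<^sub>F n in sequentially. norm (?C n)
        \<le> A * norm (real n ^ (k + 4) * ln (real n) ^ (2 * k) + real n ^ (2 * k + 3))"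
      using A(2)
    proof eventually_elim
      case (elim n)
      have "?C n \<le> real n ^ (k + 2) * ?F n" by (rule expected_cost_le_fill_in)
      also have "\<dots> \<le> real n ^ (k + 2) * (A * ?g n)" using elim by (intro mult_left_mono) auto
      also have "\<dots> = A * (real n ^ (k + 4) * ln (real n) ^ (2 * k) + real n ^ (2 * k + 3))"
        by (simp add: power_add mult_2 distrib_left mult_ac power2_eq_square numeral_eq_Suc)
      also have "\<dots> \<le> A * norm (real n ^ (k + 4) * ln (real n) ^ (2 * k) + real n ^ (2 * k + 3))"
        using A(1) by (intro mult_left_mono) auto
      finally show ?case using C by simp
    qed
  qed
  ultimately show ?thesis by blast
qed

end
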